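(* Consider the discounted MDP, the parametrized policies $\{\pi_\theta\}_{\theta\in\mathbb R^d}$ and the algorithm N-PG-IGT described in the context. Assume: (i) for all $(s,a)$, $\theta\mapsto\pi_\theta(a|s)$ is positive and twice continuously differentiable, and there are $M_g,M_h>0$ with $\|\nabla\log\pi_\theta(a|s)\|\le M_g$ and $\|\nabla^2\log\pi_\theta(a|s)\|\le M_h$ for all $\theta,s,a$; (ii) there is $l_2>0$ with $\|\nabla^2\log\pi_\theta(a|s)-\nabla^2\log\pi_{\theta'}(a|s)\|\le l_2\|\theta-\theta'\|$ for all $\theta,\theta',s,a$; (iii) there is $\mu_F>0$ with $F_\rho(\theta)\succcurlyeq\mu_F I_d$ for all $\theta\in\mathbb R^d$; (iv) there is $\varepsilon_{\rm bias}\ge0$ such that for all $\theta\in\mathbb R^d$, $\mathbb E_{s\sim d_\rho^{\pi^*},\,a\sim\pi^*(\cdot|s)}\big[(A^{\pi_\theta}(s,a)-(1-\gamma)\,w^*(\theta)^\top\nabla\log\pi_\theta(a|s))^2\big]\le\varepsilon_{\rm bias}$, where $w^*(\theta)=F_\rho(\theta)^\dagger\nabla J(\theta)$. Set $\gamma_t=\frac{6M_g}{\mu_F(t+2)}$, $\eta_t=\left(\frac{2}{t+2}\right)^{4/5}$ and $H=(1-\gamma)^{-1}\log(T+1)$. Then for every integer $T\ge1$ the output $\theta_T$ of N-PG-IGT satisfies $$J^*-\mathbb E[J(\theta_T)]\le\mathcal O\left(\frac{\sigma_g+L_h}{(T+1)^{2/5}}\right)+\frac{\sqrt{\varepsilon_{\rm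 bias}}}{1-\gamma}.$$ Hence, for every $\varepsilon>0$, the output $\theta_T$ satisfies $J^*-\mathbb E[J(\theta_T)]\le\varepsilon+\frac{\sqrt{\varepsilon_{\rm bias}}}{1-\gamma}$ for $T=\mathcal O(\varepsilon^{-2.5})$, i.e., the total sample complexity is of the order $\tilde{\mathcal O}(\varepsilon^{-2.5})$.
   Context: **MDP.** $(\mathcal S,\mathcal A,\mathcal P,r,\rho,\gamma)$: (possibly continuous) state and action spaces, transition density $\mathcal P(s'|s,a)$, reward $r:\mathcal S\times\mathcal A\to[-r_{\max},r_{\max}]$ with $r_{\max}>0$, initial distribution $\rho$, discount $\gamma\in(0,1)$. For $\theta\in\mathbb R^d$, $\pi_\theta(\cdot|s)$ is a probability density on $\mathcal A$. For a policy $\pi$, $J(\pi)=\mathbb E_{\rho,\pi}[\sum_{t\ge0}\gamma^tr(s_t,a_t)]$, with $s_0\sim\rho$, $a_t\sim\pi(\cdot|s_t)$, $s_{t+1}\sim\mathcal P(\cdot|s_t,a_t)$; $J(\theta)=J(\pi_\theta)$. $\pi^*$ is an optimal policy (maximizing the expected return), $J^*$ the optimal expected return. Derivatives are in $\theta$; norms are Euclidean/operator norms. **Other objects.** $d_\rho^\pi(\cdot)=(1-\gamma)\sum_{t\ge0}\gamma^t\,\mathbb P_{\rho,\pi}(s_t\in\cdot)$; $F_\rho(\theta)=\mathbb E_{s\sim d_\rho^{\pi_\theta},a\sim\pi_\theta(\cdot|s)}[\nabla\log\pi_\theta(a|s)\nabla\log\pi_\theta(a|s)^\top]$ with pseudo-inverse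 $F_\rho(\theta)^\dagger$; $Q^\pi(s,a)=\mathbb E_\pi[\sum_t\gamma^tr(s_t,a_t)|s_0=s,a_0=a]$, $V^\pi(s)=\mathbb E_{a\sim\pi(\cdot|s)}[Q^\pi(s,a)]$, $A^\pi=Q^\pi-V^\pi$. **Trajectories and gradient estimator.** $\tau=(s_0,a_0,\dots,s_{H-1},a_{H-1})\sim p(\cdot|\pi_\theta)$ is a trajectory of length $H$ under $\rho,\pi_\theta$ (rounding of $H$ to an integer is left implicit), and $g(\tau,\theta)=\sum_{t=0}^{H-1}\big(\sum_{h=t}^{H-1}\gamma^hr(s_h,a_h)\big)\nabla\log\pi_\theta(a_t|s_t)$. **Algorithm N-PG-IGT.** Inputs: $\theta_0,\theta_1,d_0\in\mathbb R^d$, $T$, momentum parameters $\{\eta_t\}_{t\ge0}$, step-sizes $\{\gamma_t\}_{t\ge0}$. For $t=1,\dots,T-1$: $\tilde\theta_t=\theta_t+\frac{1-\eta_t}{\eta_t}(\theta_t-\theta_{t-1})$; sample $\tilde\tau_t\sim p(\cdot|\pi_{\tilde\theta_t})$; $d_t=(1-\eta_t)d_{t-1}+\eta_tg(\tilde\tau_t,\tilde\theta_t)$; $\theta_{t+1}=\theta_t+\gamma_td_t/\|d_t\|$ (with $\theta_{t+1}=\theta_t$ if $d_t=0$). Output $\theta_T$. (The step-sizes $\gamma_t$ are distinct from the discount factor $\gamma$.) **Constants.** $\sigma_g^2=\frac{r_{\max}^2M_g^2}{(1-\gamma)^3}$; $L_h=\frac{r_{\max}M_gM_h}{(1-\gamma)^2}+\frac{r_{\max}M_g^3(1+\gamma)}{(1-\gamma)^3}+\frac{r_{\max}M_g}{1-\gamma}\max\{M_h,\frac{\gamma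 M_g^2}{1-\gamma},\frac{l_2}{M_g},\frac{M_h\gamma}{1-\gamma},\frac{M_g(1+\gamma)+M_h\gamma(1-\gamma)}{1-\gamma^2}\}$ (a Lipschitz constant of $\nabla^2J$). **Notation.** By convention, unless otherwise specified, $\mathcal O(\cdot)$ hides only absolute constants which do not depend on any problem parameter, and $\tilde{\mathcal O}(\cdot)$ hides only absolute constants and logarithmic factors.
   Formalization: The sample complexity bound carries an explicit factor 1/(1-γ): with the prescribed H = log(T+1)/(1-γ) and T of order ε^(-2.5), no absolute constant can absorb it as γ tends to 1. *)

theory Defs
  imports "HOL-Probability.Probability"
begin

definition grad :: "('v::euclidean_space \<Rightarrow> real) \<Rightarrow> 'v \<Rightarrow> 'v" where
  "grad f x = (THE D. GDERIV f x :> D)"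

text \<open>The Hessian is a bounded linear map, so \<open>norm\<close> is its operator norm.\<close>

definition hess :: "('v::euclidean_space \<Rightarrow> real) \<Rightarrow> 'v \<Rightarrow> 'v \<Rightarrow>\<^sub>L 'v" where
  "hess f x = Blinfun (frechet_derivative (grad f) (at x))"

definition twice_cont_diff :: "('v::euclidean_space \<Rightarrow> real) \<Rightarrow> bool" where
  "twice_cont_diff f \<longleftrightarrow>
     (\<forall>x. f differentiable (at x)) \<and> (\<forall>x. grad f differentiable (at x)) \<and>
     continuous_on UNIV (hess f)"

definition loewner_ge :: "real ^ 'n ^ 'n \<Rightarrow> real ^ 'n ^ 'n \<Rightarrow> bool" where
  "loewner_ge X Y \<longleftrightarrow> transpose (X - Y) = X - Y \<and> (\<forall>v. 0 \<le> v \<bullet> ((X - Y) *v v))"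

text \<open>The Moore-Penrose pseudo-inverse, by the four Penrose equations.\<close>

definition pinv :: "real ^ 'n ^ 'm \<Rightarrow> real ^ 'm ^ 'n" where
  "pinv X = (THE Y. X ** Y ** X = X \<and> Y ** X ** Y = Y \<and>
     transpose (X ** Y) = X ** Y \<and> transpose (Y ** X) = Y ** X)"

text \<open>\<open>states\<close> and \<open>actions\<close> carry the reference measures (counting measure, Lebesgue
  measure, \<dots>) with respect to which transition and policy densities are taken.\<close>

record ('s, 'a) mdp =
  states :: "'s measure"
  actions :: "'a measure"
  trans_dens :: "'s \<Rightarrow> 'a \<Rightarrow> 's \<Rightarrow> real"
  reward :: "'s \<Rightarrow> 'a \<Rightarrow> real"
  rmax :: real
  init :: "'s measure"
  disc :: real

abbreviation sa_space :: "('s, 'a) mdp \<Rightarrow> ('s \<times> 'a) measure" where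
  "sa_space M \<equiv> states M \<Otimes>\<^sub>M actions M"

definition is_mdp :: "('s, 'a) mdp \<Rightarrow> bool" where
  "is_mdp M \<longleftrightarrow>
     sigma_finite_measure (states M) \<and> sigma_finite_measure (actions M) \<and>
     (\<lambda>((s, a), s'). trans_dens M s a s') \<in> borel_measurable (sa_space M \<Otimes>\<^sub>M states M) \<and>
     (\<forall>s\<in>space (states M). \<forall>a\<in>space (actions M).
        (\<forall>s'\<in>space (states M). 0 \<le> trans_dens M s a s') \<and>
        (\<integral>\<^sup>+ s'. ennreal (trans_dens M s a s') \<partial>states M) = 1) \<and>
     (\<lambda>(s, a). reward M s a) \<in> borel_measurable (sa_space M) \<and>
     0 < rmax M \<and>
     (\<forall>s\<in>space (states M). \<forall>a\<in>space (actions M). \<bar>reward M s a\<bar> \<le> rmax M) \<and>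
     sets (init M) = sets (states M) \<and> prob_space (init M) \<and>
     0 < disc M \<and> disc M < 1"

text \<open>A policy is a probability kernel, so that deterministic policies, which need not have
  a density, compete for optimality.\<close>

definition policies :: "('s, 'a) mdp \<Rightarrow> ('s \<Rightarrow> 'a measure) set" where
  "policies M = states M \<rightarrow>\<^sub>M prob_algebra (actions M)"

definition pair_law ::
  "('s, 'a) mdp \<Rightarrow> 's measure \<Rightarrow> ('s \<Rightarrow> 'a measure) \<Rightarrow> ('s \<times> 'a) measure" where
  "pair_law M \<mu> \<kappa> = \<mu> \<bind> (\<lambda>s. \<kappa> s \<bind> (\<lambda>a. return (sa_space M) (s, a)))"

definition next_state :: "('s, 'a) mdp \<Rightarrow> 's \<times> 'a \<Rightarrow> 's measure" where
  "next_state M z = density (states M) (\<lambda>s'. ennreal (trans_dens M (fst z) (snd z) s'))"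

text \<open>The law of the \<open>n\<close>-th state-action pair given the earlier ones, where \<open>\<nu>\<close> is the law of
  pair number 0; in the form of the kernels of the Ionescu-Tulcea construction.\<close>

definition step_kernel ::
  "('s, 'a) mdp \<Rightarrow> ('s \<Rightarrow> 'a measure) \<Rightarrow> ('s \<times> 'a) measure \<Rightarrow>
   nat \<Rightarrow> (nat \<Rightarrow> 's \<times> 'a) \<Rightarrow> ('s \<times> 'a) measure" where
  "step_kernel M \<kappa> \<nu> n \<omega> =
     (if n = 0 then \<nu> else pair_law M (next_state M (\<omega> (n - 1))) \<kappa>)"

text \<open>Law of the infinite trajectory, a measure on \<open>\<Pi>\<^sub>M t\<in>UNIV. sa_space M\<close>.\<close>

definition traj ::
  "('s, 'a) mdp \<Rightarrow> ('s \<Rightarrow> 'a measure) \<Rightarrow> ('s \<times> 'a) measure \<Rightarrow> (nat \<Rightarrow> 's \<times> 'a) measure" where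
  "traj M \<kappa> \<nu> = projective_family.lim UNIV
     (Ionescu_Tulcea.CI (step_kernel M \<kappa> \<nu>) (\<lambda>_. sa_space M)) (\<lambda>_. sa_space M)"

text \<open>Law \<open>p(\<cdot>|\<pi>)\<close> of the trajectory of length \<open>H\<close> under the initial distribution,
  a measure on \<open>\<Pi>\<^sub>M t\<in>{0..<H}. sa_space M\<close>.\<close>

definition traj_upto ::
  "('s, 'a) mdp \<Rightarrow> ('s \<Rightarrow> 'a measure) \<Rightarrow> nat \<Rightarrow> (nat \<Rightarrow> 's \<times> 'a) measure" where
  "traj_upto M \<kappa> H = Ionescu_Tulcea.C (step_kernel M \<kappa> (pair_law M (init M) \<kappa>))
     (\<lambda>_. sa_space M) 0 H (\<lambda>_. undefined)"

definition disc_return :: "('s, 'a) mdp \<Rightarrow> (nat \<Rightarrow> 's \<times> 'a) \<Rightarrow> real" where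
  "disc_return M \<omega> = (\<Sum>t. disc M ^ t * reward M (fst (\<omega> t)) (snd (\<omega> t)))"

definition exp_return :: "('s, 'a) mdp \<Rightarrow> ('s \<Rightarrow> 'a measure) \<Rightarrow> real" where
  "exp_return M \<kappa> = (\<integral>\<omega>. disc_return M \<omega> \<partial>traj M \<kappa> (pair_law M (init M) \<kappa>))"

definition optimal_policy :: "('s, 'a) mdp \<Rightarrow> ('s \<Rightarrow> 'a measure) \<Rightarrow> bool" where
  "optimal_policy M \<kappa> \<longleftrightarrow>
     \<kappa> \<in> policies M \<and> (\<forall>\<kappa>'\<in>policies M. exp_return M \<kappa>' \<le> exp_return M \<kappa>)"

definition Q_fun :: "('s, 'a) mdp \<Rightarrow> ('s \<Rightarrow> 'a measure) \<Rightarrow> 's \<Rightarrow> 'a \<Rightarrow> real" where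
  "Q_fun M \<kappa> s a = (\<integral>\<omega>. disc_return M \<omega> \<partial>traj M \<kappa> (return (sa_space M) (s, a)))"

definition V_fun :: "('s, 'a) mdp \<Rightarrow> ('s \<Rightarrow> 'a measure) \<Rightarrow> 's \<Rightarrow> real" where
  "V_fun M \<kappa> s = (\<integral>a. Q_fun M \<kappa> s a \<partial>\<kappa> s)"

definition adv :: "('s, 'a) mdp \<Rightarrow> ('s \<Rightarrow> 'a measure) \<Rightarrow> 's \<Rightarrow> 'a \<Rightarrow> real" where
  "adv M \<kappa> s a = Q_fun M \<kappa> s a - V_fun M \<kappa> s"

definition visit :: "('s, 'a) mdp \<Rightarrow> ('s \<Rightarrow> 'a measure) \<Rightarrow> 's measure" where
  "visit M \<kappa> = measure_of (space (states M)) (sets (states M))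
     (\<lambda>B. \<Sum>t. ennreal ((1 - disc M) * disc M ^ t) *
        emeasure (traj M \<kappa> (pair_law M (init M) \<kappa>))
          {\<omega> \<in> space (traj M \<kappa> (pair_law M (init M) \<kappa>)). fst (\<omega> t) \<in> B})"

definition pol ::
  "('s, 'a) mdp \<Rightarrow> ('p \<Rightarrow> 's \<Rightarrow> 'a \<Rightarrow> real) \<Rightarrow> 'p \<Rightarrow> 's \<Rightarrow> 'a measure" where
  "pol M \<pi> \<theta> s = density (actions M) (\<lambda>a. ennreal (\<pi> \<theta> s a))"

definition param_policies ::
  "('s, 'a) mdp \<Rightarrow> (real ^ 'd \<Rightarrow> 's \<Rightarrow> 'a \<Rightarrow> real) \<Rightarrow> bool" where
  "param_policies M \<pi> \<longleftrightarrow>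
     (\<forall>\<theta>. (\<lambda>(s, a). \<pi> \<theta> s a) \<in> borel_measurable (sa_space M) \<and>
       (\<forall>s\<in>space (states M). (\<forall>a\<in>space (actions M). 0 \<le> \<pi> \<theta> s a) \<and>
          (\<integral>\<^sup>+ a. ennreal (\<pi> \<theta> s a) \<partial>actions M) = 1))"

definition J_fun ::
  "('s, 'a) mdp \<Rightarrow> (real ^ 'd \<Rightarrow> 's \<Rightarrow> 'a \<Rightarrow> real) \<Rightarrow> real ^ 'd \<Rightarrow> real" where
  "J_fun M \<pi> \<theta> = exp_return M (pol M \<pi> \<theta>)"

abbreviation log_pol ::
  "(real ^ 'd \<Rightarrow> 's \<Rightarrow> 'a \<Rightarrow> real) \<Rightarrow> 's \<Rightarrow> 'a \<Rightarrow> real ^ 'd \<Rightarrow> real" where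
  "log_pol \<pi> s a \<equiv> (\<lambda>\<theta>. ln (\<pi> \<theta> s a))"

definition fisher ::
  "('s, 'a) mdp \<Rightarrow> (real ^ 'd \<Rightarrow> 's \<Rightarrow> 'a \<Rightarrow> real) \<Rightarrow> real ^ 'd \<Rightarrow> real ^ 'd ^ 'd" where
  "fisher M \<pi> \<theta> = (\<chi> i j. \<integral>z. grad (log_pol \<pi> (fst z) (snd z)) \<theta> $ i *
       grad (log_pol \<pi> (fst z) (snd z)) \<theta> $ j
     \<partial>pair_law M (visit M (pol M \<pi> \<theta>)) (pol M \<pi> \<theta>))"

definition w_star ::
  "('s, 'a) mdp \<Rightarrow> (real ^ 'd \<Rightarrow> 's \<Rightarrow> 'a \<Rightarrow> real) \<Rightarrow> real ^ 'd \<Rightarrow> real ^ 'd" where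
  "w_star M \<pi> \<theta> = pinv (fisher M \<pi> \<theta>) *v grad (J_fun M \<pi>) \<theta>"

definition transfer_error ::
  "('s, 'a) mdp \<Rightarrow> (real ^ 'd \<Rightarrow> 's \<Rightarrow> 'a \<Rightarrow> real) \<Rightarrow> ('s \<Rightarrow> 'a measure) \<Rightarrow> real ^ 'd \<Rightarrow> real" where
  "transfer_error M \<pi> \<kappa> \<theta> =
     (\<integral>z. (adv M (pol M \<pi> \<theta>) (fst z) (snd z)
           - (1 - disc M) * (w_star M \<pi> \<theta> \<bullet> grad (log_pol \<pi> (fst z) (snd z)) \<theta>))\<^sup>2
      \<partial>pair_law M (visit M \<kappa>) \<kappa>)"

definition grad_est ::
  "('s, 'a) mdp \<Rightarrow> (real ^ 'd \<Rightarrow> 's \<Rightarrow> 'a \<Rightarrow> real) \<Rightarrow> nat \<Rightarrow>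
   (nat \<Rightarrow> 's \<times> 'a) \<Rightarrow> real ^ 'd \<Rightarrow> real ^ 'd" where
  "grad_est M \<pi> H \<tau> \<theta> = (\<Sum>t<H.
     (\<Sum>h=t..<H. disc M ^ h * reward M (fst (\<tau> h)) (snd (\<tau> h))) *\<^sub>R
       grad (log_pol \<pi> (fst (\<tau> t)) (snd (\<tau> t))) \<theta>)"

text \<open>Iteration \<open>t\<close> maps \<open>(\<theta>\<^sub>t\<^sub>-\<^sub>1, \<theta>\<^sub>t, d\<^sub>t\<^sub>-\<^sub>1)\<close> to the law of \<open>(\<theta>\<^sub>t, \<theta>\<^sub>t\<^sub>+\<^sub>1, d\<^sub>t)\<close>; \<open>\<eta>\<close> are the
  momentum parameters and \<open>\<alpha>\<close> the step-sizes.\<close>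

definition igt_step ::
  "('s, 'a) mdp \<Rightarrow> (real ^ 'd \<Rightarrow> 's \<Rightarrow> 'a \<Rightarrow> real) \<Rightarrow> nat \<Rightarrow> (nat \<Rightarrow> real) \<Rightarrow> (nat \<Rightarrow> real) \<Rightarrow>
   nat \<Rightarrow> (real ^ 'd) \<times> (real ^ 'd) \<times> (real ^ 'd) \<Rightarrow>
   ((real ^ 'd) \<times> (real ^ 'd) \<times> (real ^ 'd)) measure" where
  "igt_step M \<pi> H \<eta> \<alpha> t x = (case x of (\<theta>', \<theta>, d') \<Rightarrow>
     (let \<theta>t = \<theta> + ((1 - \<eta> t) / \<eta> t) *\<^sub>R (\<theta> - \<theta>')
      in distr (traj_upto M (pol M \<pi> \<theta>t) H) borel
           (\<lambda>\<tau>. let d = (1 - \<eta> t) *\<^sub>R d' + \<eta> t *\<^sub>R grad_est M \<pi> H \<tau> \<theta>t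
                in (\<theta>, if d = 0 then \<theta> else \<theta> + (\<alpha> t / norm d) *\<^sub>R d, d))))"

text \<open>Joint law of \<open>(\<theta>\<^sub>n, \<theta>\<^sub>n\<^sub>+\<^sub>1, d\<^sub>n)\<close>, i.e. after the iterations \<open>t = 1, \<dots>, n\<close>.\<close>

primrec igt_law ::
  "('s, 'a) mdp \<Rightarrow> (real ^ 'd \<Rightarrow> 's \<Rightarrow> 'a \<Rightarrow> real) \<Rightarrow> nat \<Rightarrow> (nat \<Rightarrow> real) \<Rightarrow> (nat \<Rightarrow> real) \<Rightarrow>
   real ^ 'd \<Rightarrow> real ^ 'd \<Rightarrow> real ^ 'd \<Rightarrow> nat \<Rightarrow>
   ((real ^ 'd) \<times> (real ^ 'd) \<times> (real ^ 'd)) measure" where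
  "igt_law M \<pi> H \<eta> \<alpha> \<theta>0 \<theta>1 d0 0 = return borel (\<theta>0, \<theta>1, d0)"
| "igt_law M \<pi> H \<eta> \<alpha> \<theta>0 \<theta>1 d0 (Suc n) =
     igt_law M \<pi> H \<eta> \<alpha> \<theta>0 \<theta>1 d0 n \<bind> igt_step M \<pi> H \<eta> \<alpha> (Suc n)"

text \<open>Expected return \<open>E[J(\<theta>\<^sub>T)]\<close> of the output, for \<open>T \<ge> 1\<close>.\<close>

definition igt_value ::
  "('s, 'a) mdp \<Rightarrow> (real ^ 'd \<Rightarrow> 's \<Rightarrow> 'a \<Rightarrow> real) \<Rightarrow> nat \<Rightarrow> (nat \<Rightarrow> real) \<Rightarrow> (nat \<Rightarrow> real) \<Rightarrow>
   real ^ 'd \<Rightarrow> real ^ 'd \<Rightarrow> real ^ 'd \<Rightarrow> nat \<Rightarrow> real" where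
  "igt_value M \<pi> H \<eta> \<alpha> \<theta>0 \<theta>1 d0 T =
     (\<integral>x. J_fun M \<pi> (fst (snd x)) \<partial>igt_law M \<pi> H \<eta> \<alpha> \<theta>0 \<theta>1 d0 (T - 1))"

definition stepsize :: "real \<Rightarrow> real \<Rightarrow> nat \<Rightarrow> real" where
  "stepsize Mg \<mu>F t = 6 * Mg / (\<mu>F * (real t + 2))"

definition momentum :: "nat \<Rightarrow> real" where
  "momentum t = (2 / (real t + 2)) powr (4 / 5)"

text \<open>The real-valued trajectory length is rounded up.\<close>

definition horizon :: "real \<Rightarrow> nat \<Rightarrow> nat" where
  "horizon \<gamma> T = nat \<lceil>ln (real T + 1) / (1 - \<gamma>)\<rceil>"

definition sigma_g :: "real \<Rightarrow> real \<Rightarrow> real \<Rightarrow> real" where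
  "sigma_g R \<gamma> Mg = sqrt (R\<^sup>2 * Mg\<^sup>2 / (1 - \<gamma>) ^ 3)"

definition L_h :: "real \<Rightarrow> real \<Rightarrow> real \<Rightarrow> real \<Rightarrow> real \<Rightarrow> real" where
  "L_h R \<gamma> Mg Mh l2 =
     R * Mg * Mh / (1 - \<gamma>)\<^sup>2 + R * Mg ^ 3 * (1 + \<gamma>) / (1 - \<gamma>) ^ 3
     + R * Mg / (1 - \<gamma>) *
       Max {Mh, \<gamma> * Mg\<^sup>2 / (1 - \<gamma>), l2 / Mg, Mh * \<gamma> / (1 - \<gamma>),
            (Mg * (1 + \<gamma>) + Mh * \<gamma> * (1 - \<gamma>)) / (1 - \<gamma>\<^sup>2)}"

text \<open>State-action pairs sampled in the iterations \<open>t = 1, \<dots>, T - 1\<close>.\<close>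

definition sample_count :: "real \<Rightarrow> nat \<Rightarrow> nat" where
  "sample_count \<gamma> T = (T - 1) * horizon \<gamma> T"

text \<open>A constant hidden by \<open>O(\<cdot>)\<close>. In a theorem that is polymorphic in the index type of the
  parameter space, a positive number that is merely claimed to exist could still depend on
  that type, hence on the dimension. The numeral makes the constant absolute.\<close>

definition absolute_constant :: "real \<Rightarrow> bool" where
  "absolute_constant C \<longleftrightarrow> 0 < C \<and> C \<le> 10 ^ 6"

definition smooth_policies ::
  "('s, 'a) mdp \<Rightarrow> (real ^ 'd \<Rightarrow> 's \<Rightarrow> 'a \<Rightarrow> real) \<Rightarrow> real \<Rightarrow> real \<Rightarrow> bool" where
  "smooth_policies M \<pi> Mg Mh \<longleftrightarrow> 0 < Mg \<and> 0 < Mh \<and>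
     (\<forall>s\<in>space (states M). \<forall>a\<in>space (actions M).
        twice_cont_diff (\<lambda>\<theta>. \<pi> \<theta> s a) \<and>
        (\<forall>\<theta>. 0 < \<pi> \<theta> s a \<and> norm (grad (log_pol \<pi> s a) \<theta>) \<le> Mg \<and>
             norm (hess (log_pol \<pi> s a) \<theta>) \<le> Mh))"

definition lipschitz_hess ::
  "('s, 'a) mdp \<Rightarrow> (real ^ 'd \<Rightarrow> 's \<Rightarrow> 'a \<Rightarrow> real) \<Rightarrow> real \<Rightarrow> bool" where
  "lipschitz_hess M \<pi> l2 \<longleftrightarrow> 0 < l2 \<and>
     (\<forall>s\<in>space (states M). \<forall>a\<in>space (actions M). \<forall>\<theta> \<theta>'.
        norm (hess (log_pol \<pi> s a) \<theta> - hess (log_pol \<pi> s a) \<theta>') \<le> l2 * norm (\<theta> - \<theta>'))"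

definition fisher_nondegenerate ::
  "('s, 'a) mdp \<Rightarrow> (real ^ 'd \<Rightarrow> 's \<Rightarrow> 'a \<Rightarrow> real) \<Rightarrow> real \<Rightarrow> bool" where
  "fisher_nondegenerate M \<pi> \<mu>F \<longleftrightarrow> 0 < \<mu>F \<and>
     (\<forall>\<theta>. loewner_ge (fisher M \<pi> \<theta>) (\<mu>F *\<^sub>R mat 1))"

definition compatible ::
  "('s, 'a) mdp \<Rightarrow> (real ^ 'd \<Rightarrow> 's \<Rightarrow> 'a \<Rightarrow> real) \<Rightarrow> ('s \<Rightarrow> 'a measure) \<Rightarrow> real \<Rightarrow> bool" where
  "compatible M \<pi> \<kappa> \<epsilon>b \<longleftrightarrow> 0 \<le> \<epsilon>b \<and> (\<forall>\<theta>. transfer_error M \<pi> \<kappa> \<theta> \<le> \<epsilon>b)"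

end

theory Submission
  imports Defs
begin

text \<open>The gap \<open>J\<^sup>* - J(\<theta>)\<close> is at most \<open>\<surd>\<epsilon>\<^sub>b\<^sub>i\<^sub>a\<^sub>s / (1 - \<gamma>)\<close> at \<^emph>\<open>every\<close> parameter \<open>\<theta>\<close>, so the
  rate and the sample complexity hold for any iterates. The performance difference lemma, the
  Cauchy-Schwarz inequality and the bound \<open>F \<ge> \<mu>\<^sub>F I\<close> give gradient domination,
  \<open>J\<^sup>* - J(\<theta>) \<le> \<surd>\<epsilon>\<^sub>b\<^sub>i\<^sub>a\<^sub>s / (1 - \<gamma>) + M\<^sub>g / \<mu>\<^sub>F \<cdot> \<parallel>\<nabla>J(\<theta>)\<parallel>\<close>, on the whole space; since \<open>J\<close> is bounded
  and differentiable, below every \<open>\<theta>\<close> there are points with arbitrarily small gradient.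
  Differentiability of \<open>J\<close> follows from the performance difference lemma too: applied
  to \<open>\<theta>\<close> and \<open>\<theta> + h\<close> it expresses the increment as a value of a first-order reward, and applied
  to that reward it shows that the visitation measure moves by \<open>O(\<parallel>h\<parallel>)\<close> only.\<close>

section \<open>Bounded functions under probability kernels\<close>

text \<open>Differentiation under the infinite trajectory law is avoided. Only one-time marginals
  enter, and values are set up for an arbitrary bounded reward, because the first-order term of
  \<open>J\<close> is itself the value of another reward and has to pass through the same estimates.
  Smoothness enters through ratios: \<open>p (\<theta> + h) / p \<theta>\<close> is the exponential
  of a difference of log-densities, so each pointwise error is a constant times
  \<open>p \<theta>\<close> and integrates over actions to that constant, uniformly in the state.
  The zeroth-order term drops out because an advantage has mean zero under its own policy. In the
  domination constant, 1 / \<open>\<mu>F\<close> bounds the inverse Fisher matrix and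
  \<open>Mg\<close> bounds the score. The other obstacle is measurability. The iterates are random,
  so their law is under control only if the trajectory law depends measurably on the parameter,
  whereas the assumptions give measurability of the densities for one parameter at a time.
  Continuity in the parameter bridges this.\<close>

lemma prob_algebraD:
  assumes "P \<in> space (prob_algebra N)"
  shows "prob_space P" "sets P = sets N" "space P = space N"
  using assms by (auto simp: space_prob_algebra dest: sets_eq_imp_space_eq)

lemma integrable_bounded:
  fixes f :: "'x \<Rightarrow> real"
  assumes P: "P \<in> space (prob_algebra N)"
    and f: "f \<in> borel_measurable N" "\<And>x. x \<in> space N \<Longrightarrow> \<bar>f x\<bar> \<le> B"
  shows "integrable P f"
proof -
  interpret prob_space P using P by (rule prob_algebraD)
  have [measurable]: "f \<in> borel_measurable P"
    using f(1) prob_algebraD(2)[OF P] by (simp cong: measurable_cong_sets)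
  show ?thesis
    by (rule integrable_const_bound[of _ B]) (use f(2) prob_algebraD(3)[OF P] in auto)
qed

lemma integral_bounded:
  fixes f :: "'x \<Rightarrow> real"
  assumes P: "P \<in> space (prob_algebra N)"
    and f: "f \<in> borel_measurable N" "\<And>x. x \<in> space N \<Longrightarrow> \<bar>f x\<bar> \<le> B"
  shows "\<bar>\<integral>x. f x \<partial>P\<bar> \<le> B"
proof -
  interpret prob_space P using P by (rule prob_algebraD)
  have i: "integrable P f" by (rule integrable_bounded[OF P f])
  have "(\<integral>x. f x \<partial>P) \<le> (\<integral>x. B \<partial>P)"
    using f(2) prob_algebraD(3)[OF P] by (intro integral_mono i) (auto simp: abs_le_iff)
  moreover have "(\<integral>x. - B \<partial>P) \<le> (\<integral>x. f x \<partial>P)"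
    using f(2) prob_algebraD(3)[OF P] by (intro integral_mono i) (force simp: abs_le_iff)+
  ultimately show ?thesis by (simp add: prob_space)
qed

lemma integral_bind_prob:
  fixes f :: "'y \<Rightarrow> real"
  assumes P: "P \<in> space (prob_algebra N)" and K: "K \<in> N \<rightarrow>\<^sub>M prob_algebra L"
    and f: "f \<in> borel_measurable L" "\<And>x. x \<in> space L \<Longrightarrow> \<bar>f x\<bar> \<le> B"
  shows "(\<integral>x. f x \<partial>(P \<bind> K)) = (\<integral>y. (\<integral>x. f x \<partial>K y) \<partial>P)"
proof -
  interpret prob_space P using P by (rule prob_algebraD)
  have K': "K \<in> P \<rightarrow>\<^sub>M subprob_algebra L"
    using measurable_prob_algebraD[OF K] prob_algebraD(2)[OF P] by (simp cong: measurable_cong_sets)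
  have "emeasure (K x) (space (K x)) \<le> ennreal 1" if "x \<in> space P" for x
  proof -
    have "K x \<in> space (prob_algebra L)"
      using measurable_space[OF K] that prob_algebraD(3)[OF P] by simp
    then interpret K: prob_space "K x" by (rule prob_algebraD)
    show ?thesis by (simp add: K.emeasure_space_1)
  qed
  then show ?thesis
    by (intro integral_bind[where B=B and B'=1 and K=L] f K') (auto intro: finite_measure_axioms)
qed

lemma measurable_integral_kernel [measurable (raw)]:
  fixes f :: "'y \<Rightarrow> real"
  assumes "K \<in> N \<rightarrow>\<^sub>M prob_algebra L" "f \<in> borel_measurable L"
  shows "(\<lambda>y. \<integral>x. f x \<partial>K y) \<in> borel_measurable N"
  using measurable_compose[OF measurable_prob_algebraD[OF assms(1)]
      integral_measurable_subprob_algebra[OF assms(2)]] .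

lemma bind_in_prob_algebra:
  assumes "P \<in> space (prob_algebra N)" "K \<in> N \<rightarrow>\<^sub>M prob_algebra L"
  shows "P \<bind> K \<in> space (prob_algebra L)"
  using prob_space_bind'[OF assms] sets_bind'[OF assms] by (simp add: space_prob_algebra)

lemma return_in_prob_algebra: "x \<in> space N \<Longrightarrow> return N x \<in> space (prob_algebra N)"
  by (simp add: space_prob_algebra prob_space_return)

lemma distr_in_prob_algebra:
  assumes "P \<in> space (prob_algebra N)" "f \<in> N \<rightarrow>\<^sub>M L"
  shows "distr P L f \<in> space (prob_algebra L)"
proof -
  interpret prob_space P using assms by (auto dest: prob_algebraD)
  have "f \<in> P \<rightarrow>\<^sub>M L" using assms prob_algebraD(2)[OF assms(1)] by (simp cong: measurable_cong_sets)
  then show ?thesis by (simp add: space_prob_algebra prob_space_distr)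
qed

text \<open>Serves both the transitions and the policies. Measurability in \<open>x\<close> reduces
  to that of the mass of each set, a parametric integral over a sigma-finite reference
  measure.\<close>

lemma density_kernel:
  fixes f :: "'x \<Rightarrow> 'y \<Rightarrow> real"
  assumes "sigma_finite_measure N"
    and f: "(\<lambda>(x, y). f x y) \<in> borel_measurable (L \<Otimes>\<^sub>M N)"
    and 1: "\<And>x. x \<in> space L \<Longrightarrow> (\<integral>\<^sup>+ y. ennreal (f x y) \<partial>N) = 1"
  shows "(\<lambda>x. density N (\<lambda>y. ennreal (f x y))) \<in> L \<rightarrow>\<^sub>M prob_algebra N"
proof (rule measurable_prob_algebraI)
  interpret sigma_finite_measure N by fact
  have fx [measurable]: "f x \<in> borel_measurable N" if "x \<in> space L" for x
    using measurable_compose[OF measurable_Pair1'[OF that] f] by simp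
  show pr: "prob_space (density N (\<lambda>y. ennreal (f x y)))" if "x \<in> space L" for x
    using that by (intro prob_spaceI) (simp add: emeasure_density 1 cong: nn_integral_cong)
  show "(\<lambda>x. density N (\<lambda>y. ennreal (f x y))) \<in> L \<rightarrow>\<^sub>M subprob_algebra N"
  proof (rule measurable_subprob_algebra)
    fix X assume [measurable]: "X \<in> sets N"
    note f[measurable]
    have "(\<lambda>x. \<integral>\<^sup>+ y. ennreal ((\<lambda>(x, y). f x y) (x, y)) * indicator X y \<partial>N) \<in> borel_measurable L"
      by (intro borel_measurable_nn_integral) measurable
    then show "(\<lambda>x. emeasure (density N (\<lambda>y. ennreal (f x y))) X) \<in> borel_measurable L"
      by (subst measurable_cong[of L _ "\<lambda>x. \<integral>\<^sup>+ y. ennreal (f x y) * indicator X y \<partial>N"])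
         (auto simp: emeasure_density)
  qed (auto intro: prob_space_imp_subprob_space pr)
qed

section \<open>Laws of state-action pairs\<close>

locale regular_mdp =
  fixes M :: "('s, 'a) mdp"
  assumes mdp: "is_mdp M"
begin

abbreviation "SM \<equiv> states M"
abbreviation "AM \<equiv> actions M"
abbreviation "SA \<equiv> sa_space M"

lemma disc: "0 < disc M" "disc M < 1"
  using mdp by (auto simp: is_mdp_def)

lemma reward_measurable [measurable]: "(\<lambda>z. reward M (fst z) (snd z)) \<in> borel_measurable SA"
  using mdp by (auto simp: is_mdp_def split_beta')

lemma reward_bound: "z \<in> space SA \<Longrightarrow> \<bar>reward M (fst z) (snd z)\<bar> \<le> rmax M"
  using mdp by (auto simp: is_mdp_def space_pair_measure)

lemma rmax: "0 < rmax M" using mdp by (auto simp: is_mdp_def)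

lemma init: "init M \<in> space (prob_algebra SM)"
  using mdp by (auto simp: is_mdp_def space_prob_algebra)

lemma next_state_kernel [measurable]: "next_state M \<in> SA \<rightarrow>\<^sub>M prob_algebra SM"
  unfolding next_state_def[abs_def]
  by (rule density_kernel) (use mdp in \<open>auto simp: is_mdp_def space_pair_measure split_beta'\<close>)

text \<open>Not only the state law but also the policy may vary with \<open>x\<close>; the
  trajectory law as a function of the policy parameter is later built from this form.\<close>

lemma pair_law_kernel [measurable (raw)]:
  assumes [measurable]: "\<mu> \<in> L \<rightarrow>\<^sub>M prob_algebra SM"
    and k: "(\<lambda>(x, s). \<kappa> x s) \<in> L \<Otimes>\<^sub>M SM \<rightarrow>\<^sub>M prob_algebra AM"
  shows "(\<lambda>x. pair_law M (\<mu> x) (\<kappa> x)) \<in> L \<rightarrow>\<^sub>M prob_algebra SA"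
proof -
  have [measurable]: "(\<lambda>z. \<kappa> (fst z) (snd z)) \<in> L \<Otimes>\<^sub>M SM \<rightarrow>\<^sub>M prob_algebra AM"
    using k by (simp add: split_beta')
  show ?thesis
    unfolding pair_law_def
    by (intro measurable_bind_prob_space2[where N=SM] measurable_bind_prob_space2[where N=AM])
       (auto simp: split_beta')
qed

lemma pair_law_prob:
  assumes "\<mu> \<in> space (prob_algebra SM)" "\<kappa> \<in> policies M"
  shows "pair_law M \<mu> \<kappa> \<in> space (prob_algebra SA)"
proof -
  have [measurable]: "\<kappa> \<in> SM \<rightarrow>\<^sub>M prob_algebra AM" using assms by (simp add: policies_def)
  \<comment> \<open>A single state law is a kernel from a one-point space.\<close>
  have "(\<lambda>_. pair_law M \<mu> \<kappa>) \<in> (count_space {()} \<rightarrow>\<^sub>M prob_algebra SA)"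
    using assms(1) by (intro pair_law_kernel) (auto simp: split_beta')
  then show ?thesis by (auto dest: measurable_space)
qed

lemma integral_pair_law:
  fixes f :: "'s \<times> 'a \<Rightarrow> real"
  assumes mu: "\<mu> \<in> space (prob_algebra SM)" and k: "\<kappa> \<in> policies M"
    and f [measurable]: "f \<in> borel_measurable SA" and B: "\<And>z. z \<in> space SA \<Longrightarrow> \<bar>f z\<bar> \<le> B"
  shows "(\<integral>z. f z \<partial>pair_law M \<mu> \<kappa>) = (\<integral>s. (\<integral>a. f (s, a) \<partial>\<kappa> s) \<partial>\<mu>)"
proof -
  have k' [measurable]: "\<kappa> \<in> SM \<rightarrow>\<^sub>M prob_algebra AM" using k by (simp add: policies_def)
  have K1: "(\<lambda>s. \<kappa> s \<bind> (\<lambda>a. return SA (s, a))) \<in> SM \<rightarrow>\<^sub>M prob_algebra SA"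
    by (intro measurable_bind_prob_space2[where N=AM]) (auto simp: split_beta')
  have "(\<integral>z. f z \<partial>pair_law M \<mu> \<kappa>) = (\<integral>s. (\<integral>z. f z \<partial>(\<kappa> s \<bind> (\<lambda>a. return SA (s, a)))) \<partial>\<mu>)"
    unfolding pair_law_def by (rule integral_bind_prob[OF mu K1 f B])
  also have "\<dots> = (\<integral>s. (\<integral>a. f (s, a) \<partial>\<kappa> s) \<partial>\<mu>)"
  proof (rule Bochner_Integration.integral_cong[OF refl])
    fix s assume "s \<in> space \<mu>"
    then have s: "s \<in> space SM" using prob_algebraD(3)[OF mu] by simp
    have ks: "\<kappa> s \<in> space (prob_algebra AM)" using measurable_space[OF k' s] .
    have "(\<integral>z. f z \<partial>(\<kappa> s \<bind> (\<lambda>a. return SA (s, a)))) = (\<integral>a. (\<integral>z. f z \<partial>return SA (s, a)) \<partial>\<kappa> s)"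
      by (rule integral_bind_prob[OF ks _ f B]) (use s in measurable)
    also have "\<dots> = (\<integral>a. f (s, a) \<partial>\<kappa> s)"
      using s prob_algebraD(3)[OF ks]
      by (intro Bochner_Integration.integral_cong refl integral_return) (auto simp: space_pair_measure)
    finally show "(\<integral>z. f z \<partial>(\<kappa> s \<bind> (\<lambda>a. return SA (s, a)))) = (\<integral>a. f (s, a) \<partial>\<kappa> s)" .
  qed
  finally show ?thesis .
qed

lemma policy_prob: "\<kappa> \<in> policies M \<Longrightarrow> s \<in> space SM \<Longrightarrow> \<kappa> s \<in> space (prob_algebra AM)"
  unfolding policies_def by (rule measurable_space)

lemma policy_average_measurable:
  fixes f :: "'s \<times> 'a \<Rightarrow> real"
  assumes k: "\<kappa> \<in> policies M" and f [measurable]: "f \<in> borel_measurable SA"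
  shows "(\<lambda>s. \<integral>a. f (s, a) \<partial>\<kappa> s) \<in> borel_measurable SM"
proof -
  have [measurable]: "\<kappa> \<in> SM \<rightarrow>\<^sub>M prob_algebra AM"
    using k by (simp add: policies_def)
  \<comment> \<open>The state occurs both in the integrand and in the measure; pushing
    \<open>\<kappa> s\<close> forward to pairs leaves the fixed integrand \<open>f\<close>.\<close>
  have "(\<lambda>s. \<integral>z. f z \<partial>distr (\<kappa> s) SA (\<lambda>a. (s, a))) \<in> borel_measurable SM"
    by measurable
  moreover have "(\<integral>z. f z \<partial>distr (\<kappa> s) SA (\<lambda>a. (s, a))) = (\<integral>a. f (s, a) \<partial>\<kappa> s)" if s: "s \<in> space SM" for s
  proof -
    have "sets (\<kappa> s) = sets AM"
      by (rule prob_algebraD(2)[OF policy_prob[OF k s]])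
    then have "(\<lambda>a. (s, a)) \<in> \<kappa> s \<rightarrow>\<^sub>M SA"
      using s by (subst measurable_cong_sets[OF _ refl]) auto
    then show ?thesis by (subst integral_distr) auto
  qed
  ultimately show ?thesis by (simp cong: measurable_cong)
qed

lemma integral_state_pair_law:
  fixes f :: "'s \<Rightarrow> real"
  assumes k': "\<kappa>' \<in> policies M" and mu: "\<mu> \<in> space (prob_algebra SM)"
    and f: "f \<in> borel_measurable SM" "\<And>s. s \<in> space SM \<Longrightarrow> \<bar>f s\<bar> \<le> C"
  shows "(\<integral>z. f (fst z) \<partial>pair_law M \<mu> \<kappa>') = (\<integral>s. f s \<partial>\<mu>)"
proof -
  have "(\<integral>z. f (fst z) \<partial>pair_law M \<mu> \<kappa>') = (\<integral>s. (\<integral>a. f s \<partial>\<kappa>' s) \<partial>\<mu>)"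
    using integral_pair_law[OF mu k', of "\<lambda>z. f (fst z)" C] f by (auto simp: space_pair_measure)
  also have "\<dots> = (\<integral>s. f s \<partial>\<mu>)"
  proof (rule Bochner_Integration.integral_cong[OF refl])
    fix s assume "s \<in> space \<mu>"
    then have "\<kappa>' s \<in> space (prob_algebra AM)"
      using k' prob_algebraD(3)[OF mu] by (auto simp: policies_def dest: measurable_space)
    then interpret prob_space "\<kappa>' s" by (rule prob_algebraD)
    show "(\<integral>a. f s \<partial>\<kappa>' s) = f s" by (simp add: prob_space)
  qed
  finally show ?thesis .
qed

section \<open>Marginals of the Markov chain of state-action pairs\<close>

definition step :: "('s \<Rightarrow> 'a measure) \<Rightarrow> 's \<times> 'a \<Rightarrow> ('s \<times> 'a) measure" where
  "step \<kappa> z = pair_law M (next_state M z) \<kappa>"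

primrec law :: "('s \<Rightarrow> 'a measure) \<Rightarrow> ('s \<times> 'a) measure \<Rightarrow> nat \<Rightarrow> ('s \<times> 'a) measure" where
  "law \<kappa> \<nu> 0 = \<nu>"
| "law \<kappa> \<nu> (Suc t) = law \<kappa> \<nu> t \<bind> step \<kappa>"

lemma step_kernel_prob [measurable]:
  assumes "\<kappa> \<in> policies M" shows "step \<kappa> \<in> SA \<rightarrow>\<^sub>M prob_algebra SA"
proof -
  have [measurable]: "\<kappa> \<in> SM \<rightarrow>\<^sub>M prob_algebra AM" using assms by (simp add: policies_def)
  show ?thesis unfolding step_def[abs_def] by (intro pair_law_kernel) (auto simp: split_beta')
qed

lemma law_prob:
  assumes "\<kappa> \<in> policies M" "\<nu> \<in> space (prob_algebra SA)"
  shows "law \<kappa> \<nu> t \<in> space (prob_algebra SA)"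
  by (induction t) (use assms step_kernel_prob in \<open>auto intro: bind_in_prob_algebra\<close>)

lemma Ionescu_Tulcea_step_kernel:
  assumes k: "\<kappa> \<in> policies M" and nu: "\<nu> \<in> space (prob_algebra SA)"
  shows "Ionescu_Tulcea (step_kernel M \<kappa> \<nu>) (\<lambda>_. SA)"
proof -
  have *: "step_kernel M \<kappa> \<nu> i \<in> PiM {0..<i} (\<lambda>_. SA) \<rightarrow>\<^sub>M prob_algebra SA" for i
  proof (cases i)
    case 0
    then show ?thesis using nu by (simp add: step_kernel_def[abs_def])
  next
    case (Suc j)
    have "(\<lambda>\<omega>. step \<kappa> (\<omega> j)) \<in> PiM {0..<i} (\<lambda>_. SA) \<rightarrow>\<^sub>M prob_algebra SA"
      by (rule measurable_compose[where N=SA, OF _ step_kernel_prob[OF k]]) (simp add: Suc)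
    then show ?thesis by (simp add: step_kernel_def[abs_def] step_def Suc)
  qed
  show ?thesis
  proof (rule Ionescu_Tulcea.intro)
    show "step_kernel M \<kappa> \<nu> i \<in> PiM {0..<i} (\<lambda>_. SA) \<rightarrow>\<^sub>M subprob_algebra SA" for i
      by (rule measurable_prob_algebraD[OF *])
    show "prob_space (step_kernel M \<kappa> \<nu> i x)" if "x \<in> space (PiM {0..<i} (\<lambda>_. SA))" for i x
      by (rule prob_algebraD(1)[OF measurable_space[OF * that]])
  qed
qed

text \<open>Returns are discounted sums of single-time rewards, so the projective limit enters only
  through its coordinate laws and its total mass. The coordinate laws are read off from the
  finite-horizon laws \<open>C n\<close>, whose last coordinate is drawn from the last
  kernel.\<close>

lemma traj_coordinate:
  assumes k: "\<kappa> \<in> policies M" and nu: "\<nu> \<in> space (prob_algebra SA)"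
  shows "distr (traj M \<kappa> \<nu>) SA (\<lambda>\<omega>. \<omega> t) = law \<kappa> \<nu> t"
    and "traj M \<kappa> \<nu> \<in> space (prob_algebra (PiM UNIV (\<lambda>_. SA)))"
proof -
  interpret IT: Ionescu_Tulcea "step_kernel M \<kappa> \<nu>" "\<lambda>_. SA"
    by (rule Ionescu_Tulcea_step_kernel[OF k nu])
  have traj: "traj M \<kappa> \<nu> = IT.PF.lim" by (simp add: traj_def)
  have sets_traj: "sets (traj M \<kappa> \<nu>) = sets (PiM UNIV (\<lambda>_. SA))" by (simp add: traj)
  have r[measurable]: "(\<lambda>x. restrict x J) \<in> traj M \<kappa> \<nu> \<rightarrow>\<^sub>M PiM J (\<lambda>_. SA)" for J
    by (subst measurable_cong_sets[OF sets_traj refl]) (auto intro!: measurable_restrict)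
  show "traj M \<kappa> \<nu> \<in> space (prob_algebra (PiM UNIV (\<lambda>_. SA)))"
  proof -
    \<comment> \<open>The projection to the empty index set has mass one, and push-forwards preserve
      the total mass.\<close>
    have "prob_space (distr (traj M \<kappa> \<nu>) (PiM {} (\<lambda>_. SA)) (\<lambda>x. restrict x {}))"
      unfolding traj by (subst IT.distr_lim) (auto intro: IT.PF.prob_space_P)
    then have "prob_space (traj M \<kappa> \<nu>)" by (rule prob_space_distrD[rotated]) simp
    then show ?thesis using sets_traj by (simp add: space_prob_algebra)
  qed
  define C where "C n = IT.C 0 n (\<lambda>_. undefined)" for n
  have C0: "(\<lambda>_. undefined) \<in> space (PiM {0..<0::nat} (\<lambda>_. SA))" by (simp add: space_PiM)
  have sC [measurable_cong]: "sets (C n) = sets (PiM {0..<n} (\<lambda>_. SA))" for n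
    using IT.sets_C[OF C0, of n] by (simp add: C_def)
  have pC: "prob_space (C n)" for n
    using IT.prob_space_C[OF C0] by (simp add: C_def)
  have C': "C n \<in> space (prob_algebra (PiM {0..<n} (\<lambda>_. SA)))" for n
    using pC sC by (simp add: space_prob_algebra)
  \<comment> \<open>Extending a path by \<open>IT.eP n\<close> and reading coordinate
    \<open>n\<close> returns the draw from the kernel itself.\<close>
  have C_step: "distr (C (Suc n)) SA (\<lambda>\<omega>. \<omega> n) = C n \<bind> step_kernel M \<kappa> \<nu> n" for n
  proof -
    have ne: "space (C n) \<noteq> {}" using pC by (rule prob_space.not_empty)
    have "distr (C (Suc n)) SA (\<lambda>\<omega>. \<omega> n) = distr (C n \<bind> IT.eP n) SA (\<lambda>\<omega>. \<omega> n)"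
      by (simp add: C_def)
    also have "\<dots> = C n \<bind> (\<lambda>\<omega>. distr (IT.eP n \<omega>) SA (\<lambda>\<omega>. \<omega> n))"
      using IT.measurable_eP[of n] ne
      by (intro distr_bind[where K="PiM {0..<Suc n} (\<lambda>_. SA)"]) (auto cong: measurable_cong_sets simp: sC)
    also have "\<dots> = C n \<bind> step_kernel M \<kappa> \<nu> n"
    proof (rule bind_cong[OF refl])
      fix \<omega> assume "\<omega> \<in> space (C n)"
      then have w: "\<omega> \<in> space (PiM {0..<n} (\<lambda>_. SA))" using sets_eq_imp_space_eq[OF sC] by simp
      have m: "fun_upd \<omega> n \<in> step_kernel M \<kappa> \<nu> n \<omega> \<rightarrow>\<^sub>M PiM {0..<Suc n} (\<lambda>_. SA)"
        using w by (subst measurable_cong_sets[OF IT.sets_P[OF w] refl])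
          (intro measurable_fun_upd[where J="{0..<n}"]; auto)
      have "distr (IT.eP n \<omega>) SA (\<lambda>\<omega>. \<omega> n) = distr (step_kernel M \<kappa> \<nu> n \<omega>) SA (\<lambda>x. x)"
        unfolding IT.eP_def by (subst distr_distr[OF _ m]) (auto simp: comp_def)
      also have "\<dots> = step_kernel M \<kappa> \<nu> n \<omega>"
        using IT.sets_P[OF w] by (intro distr_id2) simp
      finally show "distr (IT.eP n \<omega>) SA (\<lambda>\<omega>. \<omega> n) = step_kernel M \<kappa> \<nu> n \<omega>" .
    qed
    finally show ?thesis .
  qed
  have C_law: "distr (C (Suc n)) SA (\<lambda>\<omega>. \<omega> n) = law \<kappa> \<nu> n" for n
  proof (induction n)
    case 0
    have "C 0 \<bind> step_kernel M \<kappa> \<nu> 0 = C 0 \<bind> (\<lambda>_. \<nu>)" by (simp add: step_kernel_def[abs_def])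
    also have "\<dots> = \<nu>"
      using nu pC by (intro bind_const') (auto simp: space_prob_algebra prob_space_imp_subprob_space)
    finally show ?case by (simp add: C_step)
  next
    case (Suc n)
    have "C (Suc n) \<bind> step_kernel M \<kappa> \<nu> (Suc n) = C (Suc n) \<bind> (\<lambda>\<omega>. step \<kappa> (\<omega> n))"
      by (simp add: step_kernel_def[abs_def] step_def)
    also have "\<dots> = distr (C (Suc n)) SA (\<lambda>\<omega>. \<omega> n) \<bind> step \<kappa>"
      using prob_space.not_empty[OF pC] measurable_prob_algebraD[OF step_kernel_prob[OF k]]
      by (intro bind_distr[symmetric, where K=SA]) (auto cong: measurable_cong_sets simp: sC)
    finally show ?case by (simp only: C_step[of "Suc n"] Suc.IH law.simps)
  qed
  have "IT.CI {t} = distr (C (IT.up_to {t})) (PiM {t} (\<lambda>_. SA)) (\<lambda>f. restrict f {t})"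
    by (simp add: IT.CI_def C_def)
  \<comment> \<open>\<open>IT.up_to\<close> is an exclusive bound on the indices, so seeing
    coordinate \<open>t\<close> takes a path of length \<open>Suc t\<close>.\<close>
  moreover have "IT.up_to {t} = Suc t"
    using IT.up_to_less[of "{t}" t] IT.up_to_iff[of "{t}" "Suc t"] by auto
  ultimately have CI: "IT.CI {t} = distr (C (Suc t)) (PiM {t} (\<lambda>_. SA)) (\<lambda>f. restrict f {t})" by simp
  have "distr (traj M \<kappa> \<nu>) SA (\<lambda>\<omega>. \<omega> t) =
    distr (distr (traj M \<kappa> \<nu>) (PiM {t} (\<lambda>_. SA)) (\<lambda>x. restrict x {t})) SA (\<lambda>\<omega>. \<omega> t)"
    by (subst distr_distr) (auto simp: comp_def)
  also have "\<dots> = distr (IT.CI {t}) SA (\<lambda>\<omega>. \<omega> t)"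
    by (simp add: traj IT.distr_lim)
  also have "\<dots> = distr (C (Suc t)) SA (\<lambda>\<omega>. \<omega> t)"
  proof -
    have "(\<lambda>f. restrict f {t}) \<in> C (Suc t) \<rightarrow>\<^sub>M PiM {t} (\<lambda>_. SA)"
      by (subst measurable_cong_sets[OF sC refl]) (auto intro!: measurable_restrict)
    then show ?thesis unfolding CI by (subst distr_distr) (auto simp: comp_def)
  qed
  finally show "distr (traj M \<kappa> \<nu>) SA (\<lambda>\<omega>. \<omega> t) = law \<kappa> \<nu> t" by (simp add: C_law)
qed

end

section \<open>Discounted values and the performance difference\<close>

context regular_mdp
begin

text \<open>General in the reward \<open>g\<close> and in the starting law: besides the reward of
  the MDP it is applied to advantages and to the first-order term \<open>slope h\<close>.\<close>

definition val :: "('s \<Rightarrow> 'a measure) \<Rightarrow> ('s \<times> 'a \<Rightarrow> real) \<Rightarrow> ('s \<times> 'a) measure \<Rightarrow> real" where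
  "val \<kappa> g \<nu> = (\<Sum>t. disc M ^ t * (\<integral>z. g z \<partial>law \<kappa> \<nu> t))"

definition bdd :: "real \<Rightarrow> ('s \<times> 'a \<Rightarrow> real) \<Rightarrow> bool" where
  "bdd B g \<longleftrightarrow> g \<in> borel_measurable SA \<and> (\<forall>z\<in>space SA. \<bar>g z\<bar> \<le> B)"

lemma bddD:
  assumes "bdd B g"
  shows "g \<in> borel_measurable SA" "\<And>z. z \<in> space SA \<Longrightarrow> \<bar>g z\<bar> \<le> B"
  using assms by (auto simp: bdd_def)

lemma bdd_reward: "bdd (rmax M) (\<lambda>z. reward M (fst z) (snd z))"
  using reward_bound by (auto simp: bdd_def)

lemma bdd_diff: "bdd B f \<Longrightarrow> bdd C g \<Longrightarrow> bdd (B + C) (\<lambda>z. f z - g z)"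
  by (auto simp: bdd_def) (smt (verit, ccfv_threshold) mem_Sigma_iff space_pair_measure)

lemma bdd_scale: "bdd B f \<Longrightarrow> bdd (\<bar>c\<bar> * B) (\<lambda>z. c * f z)"
  by (auto simp: bdd_def abs_mult intro!: mult_left_mono)

lemma disc_sums: "(\<lambda>t. disc M ^ t * B) sums (B / (1 - disc M))"
  using sums_mult2[OF geometric_sums[of "disc M"], of B] disc by (simp add: field_simps)

lemma bdd_step:
  assumes k: "\<kappa> \<in> policies M" and g: "bdd B g"
  shows "bdd B (\<lambda>z. \<integral>y. g y \<partial>step \<kappa> z)"
  unfolding bdd_def
  using measurable_integral_kernel[OF step_kernel_prob[OF k] bddD(1)[OF g]]
    integral_bounded[OF measurable_space[OF step_kernel_prob[OF k]] bddD[OF g]] by auto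

context
  fixes \<kappa> \<nu> assumes k: "\<kappa> \<in> policies M" and nu: "\<nu> \<in> space (prob_algebra SA)"
begin

lemma val_term_bound:
  assumes "bdd B g" shows "\<bar>disc M ^ t * (\<integral>z. g z \<partial>law \<kappa> \<nu> t)\<bar> \<le> disc M ^ t * B"
  using mult_left_mono[OF integral_bounded[OF law_prob[OF k nu] bddD[OF assms]], of "disc M ^ t" t] disc
  by (simp add: abs_mult)

lemma val_summable:
  assumes "bdd B g" shows "summable (\<lambda>t. disc M ^ t * (\<integral>z. g z \<partial>law \<kappa> \<nu> t))"
  by (rule summable_comparison_test'[OF sums_summable[OF disc_sums[of B]]])
     (simp only: real_norm_def val_term_bound[OF assms])

lemma val_bound:
  assumes "bdd B g" shows "\<bar>val \<kappa> g \<nu>\<bar> \<le> B / (1 - disc M)"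
proof -
  have s: "summable (\<lambda>t. \<bar>disc M ^ t * (\<integral>z. g z \<partial>law \<kappa> \<nu> t)\<bar>)"
    by (rule summable_comparison_test'[OF sums_summable[OF disc_sums[of B]]])
       (simp only: real_norm_def abs_idempotent val_term_bound[OF assms])
  have "\<bar>val \<kappa> g \<nu>\<bar> \<le> (\<Sum>t. \<bar>disc M ^ t * (\<integral>z. g z \<partial>law \<kappa> \<nu> t)\<bar>)"
    unfolding val_def by (rule summable_rabs[OF s])
  also have "\<dots> \<le> (\<Sum>t. disc M ^ t * B)"
    by (intro suminf_le s val_term_bound[OF assms] sums_summable[OF disc_sums])
  finally show ?thesis using disc_sums[of B] by (simp add: sums_iff)
qed

lemma val_add:
  assumes f: "bdd B f" and g: "bdd C g"
  shows "val \<kappa> (\<lambda>z. f z + g z) \<nu> = val \<kappa> f \<nu> + val \<kappa> g \<nu>"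
proof -
  have "(\<integral>z. f z + g z \<partial>law \<kappa> \<nu> t) = (\<integral>z. f z \<partial>law \<kappa> \<nu> t) + (\<integral>z. g z \<partial>law \<kappa> \<nu> t)" for t
    by (intro Bochner_Integration.integral_add integrable_bounded[OF law_prob[OF k nu] bddD[OF f]]
        integrable_bounded[OF law_prob[OF k nu] bddD[OF g]])
  then show ?thesis
    unfolding val_def by (subst suminf_add[OF val_summable[OF f] val_summable[OF g]])
      (simp add: algebra_simps)
qed

lemma val_scale:
  assumes f: "bdd B f"
  shows "val \<kappa> (\<lambda>z. c * f z) \<nu> = c * val \<kappa> f \<nu>"
  unfolding val_def suminf_mult[OF val_summable[OF f], symmetric] by (simp add: algebra_simps)

lemma val_diff:
  assumes f: "bdd B f" and g: "bdd C g"
  shows "val \<kappa> (\<lambda>z. f z - g z) \<nu> = val \<kappa> f \<nu> - val \<kappa> g \<nu>"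
  using val_add[OF f bdd_scale[OF g, of "-1"]] val_scale[OF g, of "-1"] by simp

lemma val_cong:
  assumes "\<And>z. z \<in> space SA \<Longrightarrow> f z = g z"
  shows "val \<kappa> f \<nu> = val \<kappa> g \<nu>"
  unfolding val_def
  by (intro suminf_cong arg_cong2[where f="(*)"] refl Bochner_Integration.integral_cong assms)
     (simp add: prob_algebraD(3)[OF law_prob[OF k nu]])

text \<open>The head of the series is split off, and in the tail one transition is moved from the
  law into the integrand.\<close>

lemma val_step:
  assumes g: "bdd B g"
  shows "val \<kappa> g \<nu> = (\<integral>z. g z \<partial>\<nu>) + disc M * val \<kappa> (\<lambda>z. \<integral>y. g y \<partial>step \<kappa> z) \<nu>"
proof -
  have *: "(\<integral>z. g z \<partial>law \<kappa> \<nu> (Suc t)) = (\<integral>z. (\<integral>y. g y \<partial>step \<kappa> z) \<partial>law \<kappa> \<nu> t)" for t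
    using integral_bind_prob[OF law_prob[OF k nu] step_kernel_prob[OF k] bddD[OF g]] by simp
  note s = val_summable[OF bdd_step[OF k g]]
  have "val \<kappa> g \<nu> = (\<integral>z. g z \<partial>\<nu>) + (\<Sum>t. disc M ^ Suc t * (\<integral>z. g z \<partial>law \<kappa> \<nu> (Suc t)))"
    unfolding val_def using suminf_split_head[OF val_summable[OF g]] by simp
  also have "(\<Sum>t. disc M ^ Suc t * (\<integral>z. g z \<partial>law \<kappa> \<nu> (Suc t))) =
      disc M * val \<kappa> (\<lambda>z. \<integral>y. g y \<partial>step \<kappa> z) \<nu>"
    unfolding val_def suminf_mult[OF s, symmetric] by (simp only: * power_Suc mult.assoc)
  finally show ?thesis .
qed

end

section \<open>Action values, state values and advantages of a bounded reward\<close>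

definition qval :: "('s \<Rightarrow> 'a measure) \<Rightarrow> ('s \<times> 'a \<Rightarrow> real) \<Rightarrow> 's \<times> 'a \<Rightarrow> real" where
  "qval \<kappa> g z = val \<kappa> g (return SA z)"

definition vval :: "('s \<Rightarrow> 'a measure) \<Rightarrow> ('s \<times> 'a \<Rightarrow> real) \<Rightarrow> 's \<Rightarrow> real" where
  "vval \<kappa> g s = (\<integral>a. qval \<kappa> g (s, a) \<partial>\<kappa> s)"

definition aval :: "('s \<Rightarrow> 'a measure) \<Rightarrow> ('s \<times> 'a \<Rightarrow> real) \<Rightarrow> 's \<times> 'a \<Rightarrow> real" where
  "aval \<kappa> g z = qval \<kappa> g z - vval \<kappa> g (fst z)"

text \<open>Duality: integrating against the pair law at time \<open>t\<close> amounts to applying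
  the one-step averaging operator \<open>t\<close> times to \<open>g\<close> and integrating against
  the start. On the function side, measurability and the bound are preserved step by step.\<close>

lemma law_integral_kernel:
  assumes k: "\<kappa> \<in> policies M" and g: "bdd B g"
  shows "(\<lambda>z. \<integral>y. g y \<partial>law \<kappa> (return SA z) t) \<in> borel_measurable SA"
    and "\<nu> \<in> space (prob_algebra SA) \<Longrightarrow>
      (\<integral>z. g z \<partial>law \<kappa> \<nu> t) = (\<integral>z. (\<integral>y. g y \<partial>law \<kappa> (return SA z) t) \<partial>\<nu>)"
proof -
  define G where "G n = ((\<lambda>f z. \<integral>y. f y \<partial>step \<kappa> z) ^^ n) g" for n
  have G: "bdd B (G n)" for n
    by (induction n) (use g bdd_step[OF k] in \<open>auto simp: G_def\<close>)
  have *: "(\<integral>z. f z \<partial>law \<kappa> \<nu> t) = (\<integral>z. ((\<lambda>f z. \<integral>y. f y \<partial>step \<kappa> z) ^^ t) f z \<partial>\<nu>)"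
    if "\<nu> \<in> space (prob_algebra SA)" "bdd B f" for \<nu> f
    using that(2)
  \<comment> \<open>Each step moves one transition from the law onto the function, hence the general
    \<open>f\<close>.\<close>
  proof (induction t arbitrary: f)
    case (Suc t)
    have "(\<integral>z. f z \<partial>law \<kappa> \<nu> (Suc t)) = (\<integral>z. (\<integral>y. f y \<partial>step \<kappa> z) \<partial>law \<kappa> \<nu> t)"
      using integral_bind_prob[OF law_prob[OF k that(1)] step_kernel_prob[OF k] bddD[OF Suc.prems]] by simp
    then show ?case using Suc.IH[OF bdd_step[OF k Suc.prems]]
      by (simp add: funpow_Suc_right del: funpow.simps)
  qed simp
  have r: "(\<integral>y. g y \<partial>law \<kappa> (return SA z) t) = G t z" if "z \<in> space SA" for z
    using *[OF return_in_prob_algebra[OF that] g] integral_return[OF that bddD(1)[OF G[of t]]]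
    by (simp add: G_def)
  show "(\<lambda>z. \<integral>y. g y \<partial>law \<kappa> (return SA z) t) \<in> borel_measurable SA"
    using bddD(1)[OF G[of t]] by (simp add: r cong: measurable_cong)
  show "(\<integral>z. g z \<partial>law \<kappa> \<nu> t) = (\<integral>z. (\<integral>y. g y \<partial>law \<kappa> (return SA z) t) \<partial>\<nu>)"
    if nu: "\<nu> \<in> space (prob_algebra SA)"
    using prob_algebraD(3)[OF nu]
    by (subst *[OF nu g]) (auto simp: r G_def[symmetric] intro!: Bochner_Integration.integral_cong)
qed

context
  fixes \<kappa> g B assumes k: "\<kappa> \<in> policies M" and g: "bdd B g"
begin

lemma bdd_qval: "bdd (B / (1 - disc M)) (qval \<kappa> g)"
  unfolding bdd_def
proof (intro conjI ballI)
  show "qval \<kappa> g \<in> borel_measurable SA"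
    unfolding qval_def[abs_def] val_def
    using law_integral_kernel(1)[OF k g] by measurable
  show "\<bar>qval \<kappa> g z\<bar> \<le> B / (1 - disc M)" if "z \<in> space SA" for z
    unfolding qval_def by (rule val_bound[OF k return_in_prob_algebra[OF that] g])
qed

text \<open>Conditioning on the first pair; the geometric bound \<open>disc M ^ t * B\<close>
  justifies exchanging sum and integral.\<close>

lemma val_eq_integral_qval:
  assumes nu: "\<nu> \<in> space (prob_algebra SA)"
  shows "val \<kappa> g \<nu> = (\<integral>z. qval \<kappa> g z \<partial>\<nu>)"
proof -
  let ?f = "\<lambda>t z. disc M ^ t * (\<integral>y. g y \<partial>law \<kappa> (return SA z) t)"
  have fb: "bdd (disc M ^ t * B) (?f t)" for t
    unfolding bdd_def using law_integral_kernel(1)[OF k g, of t] val_term_bound[OF k return_in_prob_algebra g]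
    by auto
  have sn: "summable (\<lambda>t. norm (?f t z))" if "z \<in> space SA" for z
    by (rule summable_comparison_test'[OF sums_summable[OF disc_sums[of B]]])
       (simp only: real_norm_def abs_idempotent val_term_bound[OF k return_in_prob_algebra[OF that] g])
  have "(\<integral>z. qval \<kappa> g z \<partial>\<nu>) = (\<integral>z. (\<Sum>t. ?f t z) \<partial>\<nu>)"
    by (simp add: qval_def val_def)
  also have "\<dots> = (\<Sum>t. \<integral>z. ?f t z \<partial>\<nu>)"
  proof (rule integral_suminf)
    show "integrable \<nu> (?f t)" for t by (rule integrable_bounded[OF nu bddD[OF fb]])
    show "AE z in \<nu>. summable (\<lambda>t. norm (?f t z))"
      using sn prob_algebraD(3)[OF nu] by auto
    show "summable (\<lambda>t. \<integral>z. norm (?f t z) \<partial>\<nu>)"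
    proof (rule summable_comparison_test'[OF sums_summable[OF disc_sums[of B]]])
      fix t
      show "norm (\<integral>z. norm (?f t z) \<partial>\<nu>) \<le> disc M ^ t * B"
        unfolding real_norm_def
        by (rule integral_bounded[OF nu]) (use bddD[OF fb[of t]] in auto)
    qed
  qed
  also have "\<dots> = val \<kappa> g \<nu>"
    unfolding val_def using law_integral_kernel(2)[OF k g nu] by simp
  finally show ?thesis ..
qed

text \<open>After one step from \<open>z\<close> the chain is the one started from the law
  \<open>step \<kappa> z\<close>, so the tail of the series is again a discounted value.\<close>

lemma qval_Bellman:
  assumes z: "z \<in> space SA"
  shows "qval \<kappa> g z = g z + disc M * (\<integral>y. qval \<kappa> g y \<partial>step \<kappa> z)"
proof -
  note rz = return_in_prob_algebra[OF z]
  note sz = measurable_space[OF step_kernel_prob[OF k] z]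
  have law_shift: "law \<kappa> (return SA z) (Suc t) = law \<kappa> (step \<kappa> z) t" for t
  proof (induction t)
    case 0
    show ?case using bind_return[OF measurable_prob_algebraD[OF step_kernel_prob[OF k]] z] by simp
  qed simp
  have "qval \<kappa> g z = (\<integral>y. g y \<partial>return SA z) + (\<Sum>t. disc M ^ Suc t * (\<integral>y. g y \<partial>law \<kappa> (return SA z) (Suc t)))"
    unfolding qval_def val_def using suminf_split_head[OF val_summable[OF k rz g]] by simp
  also have "(\<integral>y. g y \<partial>return SA z) = g z" by (rule integral_return[OF z bddD(1)[OF g]])
  also have "(\<Sum>t. disc M ^ Suc t * (\<integral>y. g y \<partial>law \<kappa> (return SA z) (Suc t))) = disc M * val \<kappa> g (step \<kappa> z)"
    unfolding law_shift val_def suminf_mult[OF val_summable[OF k sz g], symmetric] by (simp add: mult.assoc)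
  finally show ?thesis using val_eq_integral_qval[OF sz] by simp
qed

lemma vval_measurable: "vval \<kappa> g \<in> borel_measurable SM"
  unfolding vval_def[abs_def] by (rule policy_average_measurable[OF k bddD(1)[OF bdd_qval]])

lemma vval_bound: "s \<in> space SM \<Longrightarrow> \<bar>vval \<kappa> g s\<bar> \<le> B / (1 - disc M)"
  unfolding vval_def
  using k bddD[OF bdd_qval]
  by (intro integral_bounded[where N=AM])
     (auto simp: policies_def space_pair_measure dest: measurable_space)

lemma bdd_vval: "bdd (B / (1 - disc M)) (\<lambda>z. vval \<kappa> g (fst z))"
  using vval_measurable vval_bound by (auto simp: bdd_def space_pair_measure)

lemma bdd_aval: "bdd (2 * B / (1 - disc M)) (aval \<kappa> g)"
  using bdd_diff[OF bdd_qval bdd_vval] by (simp add: aval_def[abs_def])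

lemma integral_qval_pair_law:
  assumes "\<mu> \<in> space (prob_algebra SM)"
  shows "(\<integral>z. qval \<kappa> g z \<partial>pair_law M \<mu> \<kappa>) = (\<integral>s. vval \<kappa> g s \<partial>\<mu>)"
  unfolding vval_def by (rule integral_pair_law[OF assms k bddD[OF bdd_qval]])

text \<open>Telescoping: \<open>g = q - \<gamma> P q\<close> by the Bellman equation, and the discounted sum of
  \<open>v(s\<^sub>t) - \<gamma> v(s\<^sub>t\<^sub>+\<^sub>1)\<close> collapses to \<open>v(s\<^sub>0)\<close>.\<close>

lemma performance_difference:
  assumes k': "\<kappa>' \<in> policies M" and mu: "\<mu> \<in> space (prob_algebra SM)"
  shows "val \<kappa>' g (pair_law M \<mu> \<kappa>') - val \<kappa> g (pair_law M \<mu> \<kappa>) =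
    val \<kappa>' (aval \<kappa> g) (pair_law M \<mu> \<kappa>')"
proof -
  let ?\<nu> = "pair_law M \<mu> \<kappa>'" and ?q = "qval \<kappa> g" and ?v = "\<lambda>z. vval \<kappa> g (fst z)"
  let ?Pq = "\<lambda>z. \<integral>y. ?q y \<partial>step \<kappa> z"
  note nu' = pair_law_prob[OF mu k']
  note Pq = bdd_step[OF k bdd_qval]
  have "val \<kappa>' g ?\<nu> = val \<kappa>' (\<lambda>z. ?q z - disc M * ?Pq z) ?\<nu>"
    using qval_Bellman by (intro val_cong[OF k' nu']) simp
  also have "\<dots> = val \<kappa>' ?q ?\<nu> - disc M * val \<kappa>' ?Pq ?\<nu>"
    unfolding val_diff[OF k' nu' bdd_qval bdd_scale[OF Pq]] val_scale[OF k' nu' Pq] ..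
  also have "disc M * val \<kappa>' ?Pq ?\<nu> = val \<kappa>' ?v ?\<nu> - (\<integral>z. ?v z \<partial>?\<nu>)"
  proof -
    \<comment> \<open>Here the two policies meet: \<open>vval\<close> has already averaged
      \<open>qval\<close> over the actions of \<open>\<kappa>\<close> and depends on the state only,
      and the next state has the same law whichever policy acts there.\<close>
    have "(\<integral>y. ?v y \<partial>step \<kappa>' z) = ?Pq z" if "z \<in> space SA" for z
    proof -
      note nz = measurable_space[OF next_state_kernel that]
      show ?thesis
        unfolding step_def integral_qval_pair_law[OF nz]
        by (rule integral_state_pair_law[OF k' nz vval_measurable vval_bound])
    qed
    then have "val \<kappa>' (\<lambda>z. \<integral>y. ?v y \<partial>step \<kappa>' z) ?\<nu> = val \<kappa>' ?Pq ?\<nu>"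
      by (rule val_cong[OF k' nu'])
    then show ?thesis using val_step[OF k' nu' bdd_vval] by simp
  qed
  also have "(\<integral>z. ?v z \<partial>?\<nu>) = (\<integral>s. vval \<kappa> g s \<partial>\<mu>)"
    by (rule integral_state_pair_law[OF k' mu vval_measurable vval_bound])
  also have "\<dots> = val \<kappa> g (pair_law M \<mu> \<kappa>)"
    using val_eq_integral_qval[OF pair_law_prob[OF mu k]] integral_qval_pair_law[OF mu] by simp
  finally show ?thesis
    using val_diff[OF k' nu' bdd_qval bdd_vval] by (simp add: aval_def[abs_def])
qed

end

section \<open>Returns and advantages of the MDP as instances of the discounted series\<close>

lemma integral_disc_return:
  assumes k: "\<kappa> \<in> policies M" and nu: "\<nu> \<in> space (prob_algebra SA)"
  shows "(\<integral>\<omega>. disc_return M \<omega> \<partial>traj M \<kappa> \<nu>) = val \<kappa> (\<lambda>z. reward M (fst z) (snd z)) \<nu>"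
proof -
  note tr = traj_coordinate(2)[OF k nu]
  let ?r = "\<lambda>z. reward M (fst z) (snd z)"
  let ?f = "\<lambda>t \<omega>. disc M ^ t * ?r (\<omega> t)"
  have w: "\<omega> t \<in> space SA" if "\<omega> \<in> space (PiM UNIV (\<lambda>_. SA))" for \<omega> t
    using that by (auto simp: space_PiM)
  have fm: "?f t \<in> borel_measurable (PiM UNIV (\<lambda>_. SA))" for t by measurable
  have fb: "\<bar>?f t \<omega>\<bar> \<le> disc M ^ t * rmax M" if "\<omega> \<in> space (PiM UNIV (\<lambda>_. SA))" for t \<omega>
    using reward_bound[OF w[OF that]] disc by (auto simp: abs_mult intro!: mult_left_mono)
  have "(\<integral>\<omega>. disc_return M \<omega> \<partial>traj M \<kappa> \<nu>) = (\<Sum>t. \<integral>\<omega>. ?f t \<omega> \<partial>traj M \<kappa> \<nu>)"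
    unfolding disc_return_def
  proof (rule integral_suminf)
    show "integrable (traj M \<kappa> \<nu>) (?f t)" for t by (rule integrable_bounded[OF tr fm fb])
    show "AE \<omega> in traj M \<kappa> \<nu>. summable (\<lambda>t. norm (?f t \<omega>))"
      by (rule AE_I2, rule summable_comparison_test'[OF sums_summable[OF disc_sums[of "rmax M"]]])
         (simp only: real_norm_def abs_idempotent fb prob_algebraD(3)[OF tr])
    show "summable (\<lambda>t. \<integral>\<omega>. norm (?f t \<omega>) \<partial>traj M \<kappa> \<nu>)"
    proof (rule summable_comparison_test'[OF sums_summable[OF disc_sums[of "rmax M"]]])
      fix t
      show "norm (\<integral>\<omega>. norm (?f t \<omega>) \<partial>traj M \<kappa> \<nu>) \<le> disc M ^ t * rmax M"
        unfolding real_norm_def by (rule integral_bounded[OF tr]) (use fb fm in auto)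
    qed
  qed
  also have "(\<lambda>t. \<integral>\<omega>. ?f t \<omega> \<partial>traj M \<kappa> \<nu>) = (\<lambda>t. disc M ^ t * (\<integral>z. ?r z \<partial>law \<kappa> \<nu> t))"
  proof
    fix t
    have m: "(\<lambda>\<omega>. \<omega> t) \<in> traj M \<kappa> \<nu> \<rightarrow>\<^sub>M SA"
      using prob_algebraD(2)[OF tr] by (subst measurable_cong_sets[OF _ refl]) auto
    show "(\<integral>\<omega>. ?f t \<omega> \<partial>traj M \<kappa> \<nu>) = disc M ^ t * (\<integral>z. ?r z \<partial>law \<kappa> \<nu> t)"
      unfolding traj_coordinate(1)[OF k nu, symmetric] by (subst integral_distr[OF m]) auto
  qed
  finally show ?thesis by (simp add: val_def)
qed

abbreviation "rew \<equiv> \<lambda>z. reward M (fst z) (snd z)"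

lemma exp_return_val:
  "\<kappa> \<in> policies M \<Longrightarrow> exp_return M \<kappa> = val \<kappa> rew (pair_law M (init M) \<kappa>)"
  unfolding exp_return_def by (rule integral_disc_return[OF _ pair_law_prob[OF init]])

lemma adv_aval:
  assumes k: "\<kappa> \<in> policies M" and z: "z \<in> space SA"
  shows "adv M \<kappa> (fst z) (snd z) = aval \<kappa> rew z"
proof -
  have Q: "Q_fun M \<kappa> s a = qval \<kappa> rew (s, a)" if "s \<in> space SM" "a \<in> space AM" for s a
    unfolding Q_fun_def qval_def using that
    by (intro integral_disc_return[OF k] return_in_prob_algebra) (simp add: space_pair_measure)
  have "space (\<kappa> s) = space AM" if "s \<in> space SM" for s
    by (rule prob_algebraD(3)[OF policy_prob[OF k that]])
  then have "V_fun M \<kappa> s = vval \<kappa> rew s" if "s \<in> space SM" for s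
    unfolding V_fun_def vval_def using that by (intro Bochner_Integration.integral_cong refl) (auto simp: Q)
  then show ?thesis using z Q by (auto simp: adv_def aval_def space_pair_measure)
qed

end

section \<open>Discounted state visitation\<close>

lemma integral_measure_pmf_nat:
  fixes h :: "nat \<Rightarrow> real"
  assumes "\<And>n. \<bar>h n\<bar> \<le> C"
  shows "(\<integral>n. h n \<partial>measure_pmf p) = (\<Sum>n. pmf p n * h n)"
proof -
  have "integrable (measure_pmf p) h"
    by (rule measure_pmf.integrable_const_bound[of _ C]) (use assms in auto)
  then have "integrable (count_space UNIV) (\<lambda>n. pmf p n * h n)"
    by (simp add: measure_pmf_eq_density integrable_density)
  from sums_integral_count_space_nat[OF this] show ?thesis
    by (simp add: measure_pmf_eq_density integral_density sums_iff)
qed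

context regular_mdp
begin

definition state_law :: "('s \<Rightarrow> 'a measure) \<Rightarrow> nat \<Rightarrow> 's measure" where
  "state_law \<kappa> t = distr (law \<kappa> (pair_law M (init M) \<kappa>) t) SM fst"

context
  fixes \<kappa> assumes k: "\<kappa> \<in> policies M"
begin

lemma state_law_prob: "state_law \<kappa> t \<in> space (prob_algebra SM)"
  unfolding state_law_def by (rule distr_in_prob_algebra[OF law_prob[OF k pair_law_prob[OF init k]]]) simp

lemma pair_law_bind:
  assumes P: "P \<in> space (prob_algebra N)" and K: "K \<in> N \<rightarrow>\<^sub>M prob_algebra SM"
  shows "pair_law M (P \<bind> K) \<kappa> = P \<bind> (\<lambda>x. pair_law M (K x) \<kappa>)"
proof -
  have [measurable]: "\<kappa> \<in> SM \<rightarrow>\<^sub>M prob_algebra AM" using k by (simp add: policies_def)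
  have 1: "(\<lambda>s. \<kappa> s \<bind> (\<lambda>a. return SA (s, a))) \<in> SM \<rightarrow>\<^sub>M prob_algebra SA"
    by (intro measurable_bind_prob_space2[where N=AM]) (auto simp: split_beta')
  have 2: "K \<in> P \<rightarrow>\<^sub>M subprob_algebra SM"
    using measurable_prob_algebraD[OF K] prob_algebraD(2)[OF P] by (simp cong: measurable_cong_sets)
  show ?thesis
    unfolding pair_law_def by (rule bind_assoc[OF 2 measurable_prob_algebraD[OF 1]])
qed

lemma distr_fst_pair_law:
  assumes mu: "\<mu> \<in> space (prob_algebra SM)"
  shows "distr (pair_law M \<mu> \<kappa>) SM fst = \<mu>"
proof (rule measure_eqI)
  note pl = pair_law_prob[OF mu k]
  show "sets (distr (pair_law M \<mu> \<kappa>) SM fst) = sets \<mu>" using prob_algebraD(2)[OF mu] by simp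
  fix B assume "B \<in> sets (distr (pair_law M \<mu> \<kappa>) SM fst)"
  then have B [measurable]: "B \<in> sets SM" by simp
  have d: "distr (pair_law M \<mu> \<kappa>) SM fst \<in> space (prob_algebra SM)"
    by (rule distr_in_prob_algebra[OF pl]) simp
  interpret D: prob_space "distr (pair_law M \<mu> \<kappa>) SM fst" by (rule prob_algebraD[OF d])
  interpret Mu: prob_space \<mu> by (rule prob_algebraD[OF mu])
  have fst_m: "fst \<in> pair_law M \<mu> \<kappa> \<rightarrow>\<^sub>M SM"
    using prob_algebraD(2)[OF pl] by (subst measurable_cong_sets[OF _ refl]) auto
  have "(\<integral>s. indicat_real B s \<partial>distr (pair_law M \<mu> \<kappa>) SM fst) = (\<integral>z. indicat_real B (fst z) \<partial>pair_law M \<mu> \<kappa>)"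
    by (rule integral_distr[OF fst_m]) simp
  also have "\<dots> = (\<integral>s. indicat_real B s \<partial>\<mu>)"
    by (rule integral_state_pair_law[OF k mu, where C=1]) (auto simp: indicator_def)
  finally have "measure (distr (pair_law M \<mu> \<kappa>) SM fst) B = measure \<mu> B"
    using prob_algebraD(2,3)[OF mu] B sets.sets_into_space[OF B] by (simp add: Int_absorb2)
  then show "emeasure (distr (pair_law M \<mu> \<kappa>) SM fst) B = emeasure \<mu> B"
    by (simp add: D.emeasure_eq_measure Mu.emeasure_eq_measure)
qed

text \<open>Every step draws a state and then an action from \<open>\<kappa>\<close> given that
  state. It is enough that some state law works, since taking state marginals identifies it as
  \<open>state_law \<kappa> t\<close>.\<close>

lemma law_eq_pair_law: "law \<kappa> (pair_law M (init M) \<kappa>) t = pair_law M (state_law \<kappa> t) \<kappa>"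
proof -
  have "\<exists>m\<in>space (prob_algebra SM). law \<kappa> (pair_law M (init M) \<kappa>) t = pair_law M m \<kappa>"
  proof (cases t)
    case 0
    then show ?thesis using init by auto
  next
    case (Suc n)
    let ?L = "law \<kappa> (pair_law M (init M) \<kappa>) n"
    note L = law_prob[OF k pair_law_prob[OF init k], of n]
    have "pair_law M (?L \<bind> next_state M) \<kappa> = law \<kappa> (pair_law M (init M) \<kappa>) t"
      unfolding pair_law_bind[OF L next_state_kernel] by (simp add: step_def[abs_def] Suc)
    then show ?thesis using bind_in_prob_algebra[OF L next_state_kernel] by metis
  qed
  then show ?thesis unfolding state_law_def using distr_fst_pair_law by auto
qed

text \<open>The action at each time is drawn from \<open>\<kappa>\<close> given the state and may be
  integrated out. This brings the policy into the integrand, where a change of its density can be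
  estimated.\<close>

lemma val_average:
  assumes f: "bdd B f"
  shows "val \<kappa> f (pair_law M (init M) \<kappa>) =
    val \<kappa> (\<lambda>z. \<integral>a. f (fst z, a) \<partial>\<kappa> (fst z)) (pair_law M (init M) \<kappa>)"
proof -
  have "(\<integral>z. f z \<partial>law \<kappa> (pair_law M (init M) \<kappa>) t) =
    (\<integral>z. (\<integral>a. f (fst z, a) \<partial>\<kappa> (fst z)) \<partial>law \<kappa> (pair_law M (init M) \<kappa>) t)" for t
  proof -
    note st = state_law_prob[of t]
    have "\<bar>\<integral>a. f (s, a) \<partial>\<kappa> s\<bar> \<le> B" if "s \<in> space SM" for s
      using policy_prob[OF k that] that bddD[OF f]
      by (intro integral_bounded[where N=AM]) (auto simp: space_pair_measure)
    from integral_state_pair_law[OF k st policy_average_measurable[OF k bddD(1)[OF f]] this]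
    show ?thesis
      by (simp only: law_eq_pair_law integral_pair_law[OF st k bddD[OF f]])
  qed
  then show ?thesis unfolding val_def by simp
qed

text \<open>The weights \<open>(1 - disc M) * disc M ^ t\<close> are those of a geometric time, so
  the visitation measure is the state law at an independent geometric time. This also shows that the
  set function in \<open>visit\<close> is a genuine probability measure.\<close>

lemma visit_eq_bind:
  "visit M \<kappa> = measure_pmf (geometric_pmf (1 - disc M)) \<bind> state_law \<kappa>"
proof -
  let ?P = "measure_pmf (geometric_pmf (1 - disc M))" and ?T = "traj M \<kappa> (pair_law M (init M) \<kappa>)"
  have K: "state_law \<kappa> \<in> measure_pmf (geometric_pmf (1 - disc M)) \<rightarrow>\<^sub>M subprob_algebra SM"
    using state_law_prob prob_space_imp_subprob_space
    by (auto simp: space_subprob_algebra space_prob_algebra)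
  have sets_B: "sets (?P \<bind> state_law \<kappa>) = sets SM"
    by (rule sets_bind_measurable[OF K]) simp
  have "visit M \<kappa> = measure_of (space SM) (sets SM) (emeasure (?P \<bind> state_law \<kappa>))"
    unfolding visit_def
  proof (rule measure_of_eq[OF sets.space_closed])
    fix B assume "B \<in> sigma_sets (space SM) (sets SM)"
    then have B [measurable]: "B \<in> sets SM" by (simp add: sets.sigma_sets_eq)
    note nu = pair_law_prob[OF init k]
    have "emeasure (state_law \<kappa> t) B = emeasure ?T {\<omega> \<in> space ?T. fst (\<omega> t) \<in> B}" for t
    proof -
      have m: "(\<lambda>\<omega>. \<omega> t) \<in> ?T \<rightarrow>\<^sub>M SA"
        using prob_algebraD(2)[OF traj_coordinate(2)[OF k nu]]
        by (subst measurable_cong_sets[OF _ refl]) auto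
      have "state_law \<kappa> t = distr ?T SM (\<lambda>\<omega>. fst (\<omega> t))"
        unfolding state_law_def traj_coordinate(1)[OF k nu, symmetric]
        by (subst distr_distr[OF _ m]) (auto simp: comp_def)
      moreover have "(\<lambda>\<omega>. fst (\<omega> t)) \<in> ?T \<rightarrow>\<^sub>M SM" using m by simp
      ultimately show ?thesis using B
        by (simp add: emeasure_distr vimage_def Int_def conj_commute)
    qed
    then show "(\<Sum>t. ennreal ((1 - disc M) * disc M ^ t) * emeasure ?T {\<omega> \<in> space ?T. fst (\<omega> t) \<in> B})
        = emeasure (?P \<bind> state_law \<kappa>) B"
      using disc by (subst emeasure_bind[OF _ K B])
        (auto simp: nn_integral_measure_pmf nn_integral_count_space_nat mult.commute)
  qed
  also have "\<dots> = measure_of (space (?P \<bind> state_law \<kappa>)) (sets (?P \<bind> state_law \<kappa>)) (emeasure (?P \<bind> state_law \<kappa>))"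
    using sets_eq_imp_space_eq[OF sets_B] sets_B by simp
  finally show ?thesis by (simp add: measure_of_of_measure)
qed

lemma visit_prob: "visit M \<kappa> \<in> space (prob_algebra SM)"
  unfolding visit_eq_bind using state_law_prob
  by (intro bind_in_prob_algebra[where N="count_space UNIV"])
     (auto simp: space_prob_algebra measure_pmf.prob_space_axioms)

text \<open>Averaging over the geometric time reproduces the discounted series up to the normalising
  factor.\<close>

lemma integral_visit:
  assumes f: "bdd B f"
  shows "(\<integral>z. f z \<partial>pair_law M (visit M \<kappa>) \<kappa>) = (1 - disc M) * val \<kappa> f (pair_law M (init M) \<kappa>)"
proof -
  let ?F = "\<lambda>s. \<integral>a. f (s, a) \<partial>\<kappa> s"
  have F: "?F \<in> borel_measurable SM" by (rule policy_average_measurable[OF k bddD(1)[OF f]])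
  have FB: "\<bar>?F s\<bar> \<le> B" if "s \<in> space SM" for s
    using policy_prob[OF k that] that bddD[OF f]
    by (intro integral_bounded[where N=AM]) (auto simp: space_pair_measure)
  have "(\<integral>z. f z \<partial>pair_law M (visit M \<kappa>) \<kappa>) = (\<integral>s. ?F s \<partial>visit M \<kappa>)"
    by (rule integral_pair_law[OF visit_prob k bddD[OF f]])
  also have "\<dots> = (\<integral>n. (\<integral>s. ?F s \<partial>state_law \<kappa> n) \<partial>measure_pmf (geometric_pmf (1 - disc M)))"
    unfolding visit_eq_bind using state_law_prob
    by (intro integral_bind_prob[where N="count_space UNIV" and L=SM and B=B] F FB)
       (auto simp: space_prob_algebra measure_pmf.prob_space_axioms)
  also have "\<dots> = (\<Sum>n. pmf (geometric_pmf (1 - disc M)) n * (\<integral>s. ?F s \<partial>state_law \<kappa> n))"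
    by (intro integral_measure_pmf_nat[where C=B] integral_bounded[OF state_law_prob F FB])
  also have "\<dots> = (\<Sum>n. (1 - disc M) * (disc M ^ n * (\<integral>z. f z \<partial>law \<kappa> (pair_law M (init M) \<kappa>) n)))"
    using disc by (simp add: law_eq_pair_law integral_pair_law[OF state_law_prob k bddD[OF f]] algebra_simps)
  also have "\<dots> = (1 - disc M) * val \<kappa> f (pair_law M (init M) \<kappa>)"
    unfolding val_def by (rule suminf_mult[OF val_summable[OF k pair_law_prob[OF init k] f]])
  finally show ?thesis .
qed

end

end

section \<open>Gradients\<close>

lemma GDERIV_unique:
  fixes f :: "'v::real_inner \<Rightarrow> real"
  assumes "GDERIV f x :> D" "GDERIV f x :> D'"
  shows "D = D'"
proof -
  have "(\<lambda>h. h \<bullet> D) = (\<lambda>h. h \<bullet> D')"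
    using assms unfolding gderiv_def by (rule has_derivative_unique)
  then have "h \<bullet> D = h \<bullet> D'" for h by meson
  then show ?thesis by (metis inner_eq_zero_iff inner_diff_right right_minus_eq)
qed

lemma grad_unique:
  fixes f :: "'v::euclidean_space \<Rightarrow> real"
  assumes "GDERIV f x :> D" shows "grad f x = D"
  unfolding grad_def by (rule the_equality[where P="\<lambda>D. GDERIV f x :> D", OF assms]) (rule GDERIV_unique[OF _ assms])

text \<open>In finite dimension the derivative is represented by the vector with coordinates
  \<open>f' b\<close>, so the definite description in \<open>grad\<close> has a referent.\<close>

lemma GDERIV_grad:
  fixes f :: "'v::euclidean_space \<Rightarrow> real"
  assumes "f differentiable (at x)"
  shows "GDERIV f x :> grad f x"
proof -
  obtain f' where f': "(f has_derivative f') (at x)" using assms by (auto simp: differentiable_def)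
  then have l: "linear f'" by (rule has_derivative_linear)
  have "f' h = h \<bullet> (\<Sum>b\<in>Basis. f' b *\<^sub>R b)" for h
    by (subst euclidean_representation[of h, symmetric])
       (simp add: inner_sum_right linear_sum[OF l] linear_cmul[OF l] mult.commute)
  then have "GDERIV f x :> (\<Sum>b\<in>Basis. f' b *\<^sub>R b)"
    using f' unfolding gderiv_def by (metis (no_types, lifting) ext)
  then show ?thesis using grad_unique by metis
qed

text \<open>For \<open>u = - x\<close> negative, the upper half follows because
  \<open>1 - x + x\<^sup>2\<close> times the quadratic Taylor polynomial of exp at \<open>x\<close>
  is at least one; the lower half is the tangent line.\<close>

lemma exp_bound_quadratic:
  fixes u :: real
  assumes "\<bar>u\<bar> \<le> 1"
  shows "\<bar>exp u - 1 - u\<bar> \<le> u\<^sup>2"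
proof (cases "0 \<le> u")
  case True
  with assms have "exp u \<le> 1 + u + u\<^sup>2" by (intro exp_bound) auto
  then show ?thesis
    using exp_ge_add_one_self[of u] zero_le_power2[of u] unfolding abs_le_iff by (intro conjI; linarith)
next
  case False
  define x where "x = - u"
  have x: "0 \<le> x" "u = - x" using False by (auto simp: x_def)
  have "1 \<le> (1 - x + x\<^sup>2) * (1 + x + x\<^sup>2 / 2)"
  proof -
    have "(1 - x + x\<^sup>2) * (1 + x + x\<^sup>2 / 2) = 1 + (x\<^sup>2 + x ^ 3 + x ^ 4) / 2"
      by (simp add: field_simps power2_eq_square power3_eq_cube power4_eq_xxxx)
    then show ?thesis using x by simp
  qed
  also have "\<dots> \<le> (1 - x + x\<^sup>2) * exp x"
  proof (rule mult_left_mono)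
    show "1 + x + x\<^sup>2 / 2 \<le> exp x" using exp_lower_Taylor_quadratic[OF x(1)] by simp
    have "1 - x + x\<^sup>2 = (x - 1/2)\<^sup>2 + 3/4" by (simp add: power2_eq_square field_simps)
    then show "0 \<le> 1 - x + x\<^sup>2" by simp
  qed
  finally have "exp (- x) \<le> 1 - x + x\<^sup>2" by (simp add: exp_minus field_simps)
  then show ?thesis using exp_ge_add_one_self[of u] by (simp add: x(2))
qed

text \<open>Caratheodory functions: evaluate at the first point of a countable dense set that is
  \<open>1/n\<close>-close to the continuous argument, and let \<open>n\<close> tend to infinity.\<close>

lemma borel_measurable_Caratheodory:
  fixes f :: "'v::{second_countable_topology, metric_space} \<Rightarrow> 'x \<Rightarrow> real"
  assumes cont: "\<And>x. x \<in> space N \<Longrightarrow> continuous_on UNIV (\<lambda>v. f v x)"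
    and meas: "\<And>v. f v \<in> borel_measurable N"
  shows "(\<lambda>(v, x). f v x) \<in> borel_measurable (borel \<Otimes>\<^sub>M N)"
proof -
  obtain D :: "'v set" where D: "countable D" "\<And>X. open X \<Longrightarrow> X \<noteq> {} \<Longrightarrow> \<exists>d\<in>D. d \<in> X"
    using countable_dense_exists by blast
  define e where "e = from_nat_into D"
  have De: "D \<subseteq> range e" using D(1) by (auto simp: e_def subset_range_from_nat_into)
  define idx where "idx n v = (LEAST k. dist (e k) v < 1 / real (Suc n))" for n v
  have idx: "dist (e (idx n v)) v < 1 / real (Suc n)" for n v
  proof -
    have "v \<in> ball v (1 / real (Suc n))" by simp
    then obtain d where "d \<in> D" "d \<in> ball v (1 / real (Suc n))"
      using D(2)[of "ball v (1 / real (Suc n))"] by blast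
    then obtain k where "dist (e k) v < 1 / real (Suc n)" using De by (auto simp: dist_commute)
    then show ?thesis unfolding idx_def by (rule LeastI)
  qed
  have [measurable]: "idx n \<in> borel \<rightarrow>\<^sub>M count_space UNIV" for n
    unfolding idx_def by measurable
  show ?thesis
  proof (rule borel_measurable_LIMSEQ_real)
    fix z assume "z \<in> space ((borel :: 'v measure) \<Otimes>\<^sub>M N)"
    then obtain v x where z: "z = (v, x)" and x: "x \<in> space N" by (auto simp: space_pair_measure)
    have "dist (e (idx n v)) v \<le> inverse (real (Suc n))" for n
      using less_imp_le[OF idx[of n v]] unfolding inverse_eq_divide .
    then have "(\<lambda>n. dist (e (idx n v)) v) \<longlonglongrightarrow> 0"
      by (intro tendsto_sandwich[OF _ _ tendsto_const LIMSEQ_inverse_real_of_nat] always_eventually allI)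
         (rule zero_le_dist)
    then have "(\<lambda>n. e (idx n v)) \<longlonglongrightarrow> v" by (subst tendsto_dist_iff)
    then have "(\<lambda>n. f (e (idx n v)) x) \<longlonglongrightarrow> f v x"
      using cont[OF x] continuous_on_tendsto_compose[of UNIV "\<lambda>v. f v x"] by simp
    then show "(\<lambda>n. case z of (v, x) \<Rightarrow> f (e (idx n v)) x) \<longlonglongrightarrow> (case z of (v, x) \<Rightarrow> f v x)"
      by (simp add: z)
  next
    fix n
    have [measurable]: "(\<lambda>z. f (e k) (snd z)) \<in> borel_measurable (borel \<Otimes>\<^sub>M N)" for k
      using meas by measurable
    have "(\<lambda>z. f (e (idx n (fst z))) (snd z)) \<in> borel_measurable (borel \<Otimes>\<^sub>M N)"
      by (rule measurable_compose_countable[where f="\<lambda>k z. f (e k) (snd z)"]) measurable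
    then show "(\<lambda>z. case z of (v, x) \<Rightarrow> f (e (idx n v)) x) \<in> borel_measurable (borel \<Otimes>\<^sub>M N)"
      by (simp add: split_beta')
  qed
qed

text \<open>Each coordinate is a pointwise limit of difference quotients with increments
  \<open>inverse (real (Suc n))\<close>, which are jointly measurable.\<close>

lemma borel_measurable_grad:
  fixes f :: "'v::euclidean_space \<Rightarrow> 'x \<Rightarrow> real"
  assumes diff: "\<And>v x. x \<in> space N \<Longrightarrow> (\<lambda>v. f v x) differentiable (at v)"
    and f: "(\<lambda>(v, x). f v x) \<in> borel_measurable (borel \<Otimes>\<^sub>M N)"
  shows "(\<lambda>(v, x). grad (\<lambda>v. f v x) v) \<in> borel_measurable (borel \<Otimes>\<^sub>M N)"
proof (subst borel_measurable_euclidean_space, intro ballI)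
  fix b :: 'v assume "b \<in> Basis"
  note [measurable] = f
  show "(\<lambda>z. (case z of (v, x) \<Rightarrow> grad (\<lambda>v. f v x) v) \<bullet> b) \<in> borel_measurable (borel \<Otimes>\<^sub>M N)"
  proof (rule borel_measurable_LIMSEQ_real)
    let ?q = "\<lambda>n z. (case_prod f (fst z + inverse (real (Suc n)) *\<^sub>R b, snd z) - case_prod f z) / inverse (real (Suc n))"
    show "?q n \<in> borel_measurable (borel \<Otimes>\<^sub>M N)" for n by measurable
    fix z assume "z \<in> space ((borel :: 'v measure) \<Otimes>\<^sub>M N)"
    then obtain v x where z: "z = (v, x)" and x: "x \<in> space N" by (auto simp: space_pair_measure)
    have "((\<lambda>v. f v x) has_derivative (\<lambda>h. h \<bullet> grad (\<lambda>v. f v x) v)) (at (v + 0 *\<^sub>R b))"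
      using GDERIV_grad[OF diff[OF x, of v]] by (simp add: gderiv_def)
    then have "((\<lambda>t. f (v + t *\<^sub>R b) x) has_derivative (\<lambda>h. (h *\<^sub>R b) \<bullet> grad (\<lambda>v. f v x) v)) (at 0)"
      by (rule has_derivative_compose[rotated]) (auto intro!: derivative_eq_intros)
    then have "((\<lambda>t. f (v + t *\<^sub>R b) x) has_real_derivative (b \<bullet> grad (\<lambda>v. f v x) v)) (at 0)"
      by (simp add: has_field_derivative_def mult_commute_abs)
    then have "((\<lambda>t. (f (v + t *\<^sub>R b) x - f v x) / t) \<longlongrightarrow> b \<bullet> grad (\<lambda>v. f v x) v) (at 0)"
      by (simp add: DERIV_def)
    then have "(\<lambda>n. (f (v + inverse (real (Suc n)) *\<^sub>R b) x - f v x) / inverse (real (Suc n)))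
        \<longlonglongrightarrow> b \<bullet> grad (\<lambda>v. f v x) v"
      by (rule filterlim_compose) (intro filterlim_atI LIMSEQ_inverse_real_of_nat, simp)
    then show "(\<lambda>n. ?q n z) \<longlonglongrightarrow> (case z of (v, x) \<Rightarrow> grad (\<lambda>v. f v x) v) \<bullet> b"
      by (simp add: z inner_commute)
  qed
qed

section \<open>Differentiability of the value in the policy parameter\<close>

locale policy_class = regular_mdp M for M :: "('s, 'a) mdp" +
  fixes \<pi> :: "real ^ 'd \<Rightarrow> 's \<Rightarrow> 'a \<Rightarrow> real" and Mg Mh :: real
  assumes param: "param_policies M \<pi>" and smooth: "smooth_policies M \<pi> Mg Mh"
begin

definition score :: "real ^ 'd \<Rightarrow> 's \<times> 'a \<Rightarrow> real ^ 'd" where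
  "score \<theta> z = grad (log_pol \<pi> (fst z) (snd z)) \<theta>"

lemma Mg_pos: "0 < Mg" and Mh_pos: "0 < Mh"
  using smooth by (auto simp: smooth_policies_def)

text \<open>Measurability in the pair is assumed for each fixed parameter, and differentiability
  gives continuity in the parameter; together they give joint measurability, which kernels over
  random iterates require.\<close>

lemma pol_kernel_joint [measurable]:
  "(\<lambda>(\<theta>, s). pol M \<pi> \<theta> s) \<in> borel \<Otimes>\<^sub>M SM \<rightarrow>\<^sub>M prob_algebra AM"
  and pi_joint: "(\<lambda>(\<theta>, z). \<pi> \<theta> (fst z) (snd z)) \<in> borel_measurable (borel \<Otimes>\<^sub>M SA)"
proof -
  show pj: "(\<lambda>(\<theta>, z). \<pi> \<theta> (fst z) (snd z)) \<in> borel_measurable (borel \<Otimes>\<^sub>M SA)"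
  proof (rule borel_measurable_Caratheodory)
    show "continuous_on UNIV (\<lambda>\<theta>. \<pi> \<theta> (fst z) (snd z))" if "z \<in> space SA" for z
      using smooth that
      by (auto simp: smooth_policies_def twice_cont_diff_def space_pair_measure
          intro!: differentiable_imp_continuous_on differentiable_at_withinI simp: differentiable_on_def)
    show "(\<lambda>z. \<pi> \<theta> (fst z) (snd z)) \<in> borel_measurable SA" for \<theta>
      using param by (simp add: param_policies_def split_beta')
  qed
  have "(\<lambda>y. (fst (fst y), (snd (fst y), snd y))) \<in> (borel \<Otimes>\<^sub>M SM) \<Otimes>\<^sub>M AM \<rightarrow>\<^sub>M borel \<Otimes>\<^sub>M SA"
    by measurable
  from measurable_compose[OF this pj]
  have m: "(\<lambda>(x, a). \<pi> (fst x) (snd x) a) \<in> borel_measurable ((borel \<Otimes>\<^sub>M SM) \<Otimes>\<^sub>M AM)"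
    by (simp add: split_beta')
  have "(\<lambda>x. density AM (\<lambda>a. ennreal (\<pi> (fst x) (snd x) a))) \<in> borel \<Otimes>\<^sub>M SM \<rightarrow>\<^sub>M prob_algebra AM"
    by (rule density_kernel[OF _ m])
      (use mdp param in \<open>auto simp: is_mdp_def param_policies_def space_pair_measure\<close>)
  then show "(\<lambda>(\<theta>, s). pol M \<pi> \<theta> s) \<in> borel \<Otimes>\<^sub>M SM \<rightarrow>\<^sub>M prob_algebra AM"
    by (simp add: pol_def split_beta')
qed

lemma pol_policies: "pol M \<pi> \<theta> \<in> policies M"
  unfolding policies_def using measurable_compose[OF measurable_Pair1'[of \<theta> borel SM] pol_kernel_joint]
  by simp

section \<open>Pointwise estimates at a fixed state-action pair\<close>

context
  fixes z assumes z: "z \<in> space SA"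
begin

abbreviation "p \<equiv> \<lambda>\<theta>. \<pi> \<theta> (fst z) (snd z)"
abbreviation "l \<equiv> log_pol \<pi> (fst z) (snd z)"

lemma policy_regularity:
  "p differentiable (at \<theta>)" "grad p differentiable (at \<theta>)" "0 < p \<theta>"
  "norm (score \<theta> z) \<le> Mg" "norm (hess l \<theta>) \<le> Mh"
  using smooth z by (auto simp: smooth_policies_def twice_cont_diff_def space_pair_measure score_def)

lemma GDERIV_log: "GDERIV l \<theta> :> (1 / p \<theta>) *\<^sub>R grad p \<theta>"
  using GDERIV_DERIV_compose[OF GDERIV_grad[OF policy_regularity(1)] DERIV_ln_divide[OF policy_regularity(3)]] .

lemma log_differentiable: "l differentiable (at \<theta>)"
  using GDERIV_log unfolding gderiv_def differentiable_def by blast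

lemma log_has_derivative: "(l has_derivative (\<lambda>h. h \<bullet> score \<theta> z)) (at \<theta>)"
  using GDERIV_grad[OF log_differentiable] by (simp add: gderiv_def score_def)

text \<open>\<open>hess\<close> is built from \<open>frechet_derivative\<close> and is meaningful
  only where the gradient is differentiable; writing the score as the gradient of \<open>p\<close>
  divided by \<open>p\<close> supplies this.\<close>

lemma score_has_derivative: "((\<lambda>\<theta>. score \<theta> z) has_derivative blinfun_apply (hess l \<theta>)) (at \<theta>)"
proof -
  have g: "grad l = (\<lambda>\<theta>. (1 / p \<theta>) *\<^sub>R grad p \<theta>)"
    using grad_unique[OF GDERIV_log] by blast
  have "p \<theta> \<noteq> 0" using policy_regularity(3)[of \<theta>] by simp
  then have "grad l differentiable (at \<theta>)"
    unfolding g by (intro derivative_intros policy_regularity(1,2))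
  then have *: "(grad l has_derivative frechet_derivative (grad l) (at \<theta>)) (at \<theta>)"
    by (simp add: frechet_derivative_works)
  then show ?thesis
    using bounded_linear_Blinfun_apply[OF has_derivative_bounded_linear[OF *]]
    by (simp add: hess_def score_def[abs_def])
qed

lemma score_Lipschitz: "norm (score x z - score y z) \<le> Mh * norm (x - y)"
  by (rule differentiable_bound[OF convex_UNIV, of "\<lambda>\<theta>. score \<theta> z" "\<lambda>\<theta>. blinfun_apply (hess l \<theta>)"])
     (use score_has_derivative policy_regularity(5) in \<open>auto simp: norm_blinfun.rep_eq\<close>)

lemma log_Lipschitz: "\<bar>l x - l y\<bar> \<le> Mg * norm (x - y)"
proof -
  have "onorm (\<lambda>h. h \<bullet> score \<theta> z) \<le> Mg" for \<theta>
  proof (rule onorm_bound)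
    show "norm (h \<bullet> score \<theta> z) \<le> Mg * norm h" for h
      using order_trans[OF Cauchy_Schwarz_ineq2 mult_left_mono[OF policy_regularity(4)]]
      by (simp add: mult.commute)
  qed (use Mg_pos in simp)
  then show ?thesis
    using differentiable_bound[OF convex_UNIV, of l "\<lambda>\<theta> h. h \<bullet> score \<theta> z" Mg x y] log_has_derivative
    by (simp add: has_derivative_at_withinI)
qed

text \<open>Mean value inequality for \<open>l\<close> minus its linear part: on the ball of radius
  \<open>norm h\<close> the derivative is given by a difference of scores, of size at most
  \<open>Mh * norm h\<close>.\<close>

lemma log_Taylor: "\<bar>l (\<theta> + h) - l \<theta> - h \<bullet> score \<theta> z\<bar> \<le> Mh * (norm h)\<^sup>2"
proof -
  let ?g = "\<lambda>x. l x - x \<bullet> score \<theta> z"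
  have "norm (?g (\<theta> + h) - ?g \<theta>) \<le> (Mh * norm h) * norm ((\<theta> + h) - \<theta>)"
  proof (rule differentiable_bound[OF convex_cball[of \<theta> "norm h"]])
    show "(?g has_derivative (\<lambda>k. k \<bullet> score x z - k \<bullet> score \<theta> z)) (at x within cball \<theta> (norm h))" for x
      by (intro has_derivative_diff has_derivative_at_withinI[OF log_has_derivative]
          has_derivative_inner_left has_derivative_ident)
    show "onorm (\<lambda>k. k \<bullet> score x z - k \<bullet> score \<theta> z) \<le> Mh * norm h" if "x \<in> cball \<theta> (norm h)" for x
    proof (rule onorm_bound)
      fix k
      have "norm (k \<bullet> score x z - k \<bullet> score \<theta> z) = \<bar>k \<bullet> (score x z - score \<theta> z)\<bar>"
        by (simp add: inner_diff_right)
      also have "\<dots> \<le> norm k * (Mh * norm (x - \<theta>))"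
        using order_trans[OF Cauchy_Schwarz_ineq2 mult_left_mono[OF score_Lipschitz]] by simp
      also have "\<dots> \<le> norm k * (Mh * norm h)"
        using that Mh_pos by (intro mult_left_mono) (auto simp: dist_norm norm_minus_commute)
      finally show "norm (k \<bullet> score x z - k \<bullet> score \<theta> z) \<le> Mh * norm h * norm k" by (simp add: mult.commute)
    qed (use Mh_pos in simp)
  qed (auto simp: dist_norm)
  then show ?thesis by (simp add: inner_add_left power2_eq_square algebra_simps)
qed

lemma policy_ratio: "p (\<theta> + h) = p \<theta> * exp (l (\<theta> + h) - l \<theta>)"
  using policy_regularity(3)[of \<theta>] policy_regularity(3)[of "\<theta> + h"] by (simp add: exp_diff)

text \<open>Stated relative to \<open>p \<theta>\<close>, since such a bound integrates over actions
  to the constant in front. The restriction on \<open>h\<close> keeps the log-ratio in [-1, 1],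
  where \<open>exp_bound_quadratic\<close> applies.\<close>

lemma policy_ratio_bound:
  assumes "Mg * norm h \<le> 1"
  shows "\<bar>p (\<theta> + h) - p \<theta>\<bar> \<le> (2 * Mg * norm h) * p \<theta>"
proof -
  define u where "u = l (\<theta> + h) - l \<theta>"
  have ratio: "p (\<theta> + h) = p \<theta> * exp u" unfolding u_def by (rule policy_ratio)
  have u: "\<bar>u\<bar> \<le> Mg * norm h" using log_Lipschitz[of "\<theta> + h" \<theta>] by (simp add: u_def)
  then have "\<bar>exp u - 1 - u\<bar> \<le> u\<^sup>2" using assms by (intro exp_bound_quadratic) simp
  \<comment> \<open>Absorbing the square into the linear term produces the factor 2.\<close>
  moreover have "u\<^sup>2 \<le> \<bar>u\<bar>" using u assms mult_left_mono[of "\<bar>u\<bar>" 1 "\<bar>u\<bar>"] by (simp add: power2_eq_square)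
  ultimately have "\<bar>exp u - 1\<bar> \<le> 2 * Mg * norm h" using u by linarith
  then have "\<bar>exp u - 1\<bar> * p \<theta> \<le> (2 * Mg * norm h) * p \<theta>"
    using policy_regularity(3)[of \<theta>] by (intro mult_right_mono) auto
  moreover have "\<bar>p (\<theta> + h) - p \<theta>\<bar> = \<bar>exp u - 1\<bar> * p \<theta>"
  proof -
    have "p (\<theta> + h) - p \<theta> = (exp u - 1) * p \<theta>"
      by (subst ratio) (simp add: algebra_simps)
    then show ?thesis using policy_regularity(3)[of \<theta>] by (simp add: abs_mult)
  qed
  ultimately show ?thesis by simp
qed

text \<open>Two quadratic errors add up: \<open>Mg\<^sup>2\<close> from expanding exp at the
  log-ratio, \<open>Mh\<close> from replacing the log-ratio by its linear part.\<close>

lemma policy_ratio_Taylor: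
  assumes "Mg * norm h \<le> 1"
  shows "\<bar>p (\<theta> + h) - p \<theta> - p \<theta> * (h \<bullet> score \<theta> z)\<bar> \<le> ((Mg\<^sup>2 + Mh) * (norm h)\<^sup>2) * p \<theta>"
proof -
  define u where "u = l (\<theta> + h) - l \<theta>"
  have ratio: "p (\<theta> + h) = p \<theta> * exp u" unfolding u_def by (rule policy_ratio)
  have u: "\<bar>u\<bar> \<le> Mg * norm h" using log_Lipschitz[of "\<theta> + h" \<theta>] by (simp add: u_def)
  then have "\<bar>exp u - 1 - u\<bar> \<le> u\<^sup>2" using assms by (intro exp_bound_quadratic) simp
  moreover have "u\<^sup>2 \<le> Mg\<^sup>2 * (norm h)\<^sup>2"
    using power_mono[OF u, of 2] by (simp add: power_mult_distrib)
  moreover have "\<bar>u - h \<bullet> score \<theta> z\<bar> \<le> Mh * (norm h)\<^sup>2"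
    using log_Taylor[of \<theta> h] by (simp add: u_def)
  ultimately have "\<bar>exp u - 1 - h \<bullet> score \<theta> z\<bar> \<le> (Mg\<^sup>2 + Mh) * (norm h)\<^sup>2"
    by (simp add: distrib_right)
  then have "\<bar>exp u - 1 - h \<bullet> score \<theta> z\<bar> * p \<theta> \<le> ((Mg\<^sup>2 + Mh) * (norm h)\<^sup>2) * p \<theta>"
    using policy_regularity(3)[of \<theta>] by (intro mult_right_mono) auto
  moreover have "\<bar>p (\<theta> + h) - p \<theta> - p \<theta> * (h \<bullet> score \<theta> z)\<bar> = \<bar>exp u - 1 - h \<bullet> score \<theta> z\<bar> * p \<theta>"
  proof -
    have "p (\<theta> + h) - p \<theta> - p \<theta> * (h \<bullet> score \<theta> z) = (exp u - 1 - h \<bullet> score \<theta> z) * p \<theta>"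
      by (subst ratio) (simp add: algebra_simps)
    then show ?thesis using policy_regularity(3)[of \<theta>] by (simp add: abs_mult)
  qed
  ultimately show ?thesis by simp
qed

end

lemma score_joint [measurable]: "(\<lambda>(\<theta>, z). score \<theta> z) \<in> borel_measurable (borel \<Otimes>\<^sub>M SA)"
  unfolding score_def
proof (rule borel_measurable_grad)
  show "log_pol \<pi> (fst z) (snd z) differentiable (at \<theta>)" if "z \<in> space SA" for \<theta> z
    by (rule log_differentiable[OF that])
  show "(\<lambda>(\<theta>, z). ln (\<pi> \<theta> (fst z) (snd z))) \<in> borel_measurable (borel \<Otimes>\<^sub>M SA)"
    using borel_measurable_ln[OF pi_joint] by (simp add: split_beta')
qed

lemma score_measurable [measurable]: "score \<theta> \<in> borel_measurable SA"
  using measurable_compose[OF measurable_Pair1'[of \<theta> borel SA] score_joint] by simp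

lemma bdd_score: "bdd (norm h * Mg) (\<lambda>z. h \<bullet> score \<theta> z)"
  unfolding bdd_def
proof (intro conjI ballI)
  show "\<bar>h \<bullet> score \<theta> z\<bar> \<le> norm h * Mg" if "z \<in> space SA" for z
    using order_trans[OF Cauchy_Schwarz_ineq2 mult_left_mono[OF policy_regularity(4)[OF that]]] by simp
qed measurable

lemma bdd_mult: "bdd B f \<Longrightarrow> bdd C g \<Longrightarrow> bdd (B * C) (\<lambda>z. f z * g z)"
  unfolding bdd_def abs_mult
  by (intro conjI ballI mult_mono borel_measurable_times) (blast intro: order_trans[OF abs_ge_zero] abs_ge_zero)+

text \<open>\<open>k\<close> is the relative first-order change of the density: zero yields a
  Lipschitz bound, the score in direction \<open>h\<close> a Taylor bound. All expectations are
  rewritten over the reference measure, where the densities can be subtracted pointwise.\<close>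

lemma policy_perturbation:
  assumes s: "s \<in> space SM" and f: "bdd C f" and k: "bdd D k"
    and pert: "\<And>a. a \<in> space AM \<Longrightarrow> \<bar>\<pi> \<theta>' s a - \<pi> \<theta> s a - \<pi> \<theta> s a * k (s, a)\<bar> \<le> c * \<pi> \<theta> s a"
  shows "\<bar>(\<integral>a. f (s, a) \<partial>pol M \<pi> \<theta>' s) - (\<integral>a. f (s, a) \<partial>pol M \<pi> \<theta> s)
    - (\<integral>a. k (s, a) * f (s, a) \<partial>pol M \<pi> \<theta> s)\<bar> \<le> c * C"
proof -
  note [measurable] = bddD(1)[OF f] bddD(1)[OF k]
  have sa: "(s, a) \<in> space SA" if "a \<in> space AM" for a using s that by (simp add: space_pair_measure)
  have pos: "0 < \<pi> \<theta> s a" if "a \<in> space AM" for \<theta> a using policy_regularity(3)[OF sa[OF that]] by simp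
  have pm [measurable]: "\<pi> \<theta> s \<in> borel_measurable AM" for \<theta>
  proof -
    have "(\<lambda>(s, a). \<pi> \<theta> s a) \<in> borel_measurable SA" using param by (simp add: param_policies_def)
    from measurable_compose[OF measurable_Pair1'[OF s] this] show ?thesis by simp
  qed
  have I: "integrable AM (\<lambda>a. \<pi> \<theta> s a * q (s, a)) \<and>
      (\<integral>a. q (s, a) \<partial>pol M \<pi> \<theta> s) = (\<integral>a. \<pi> \<theta> s a * q (s, a) \<partial>AM)" if q: "bdd E q" for E q \<theta>
  proof -
    have qm: "(\<lambda>a. q (s, a)) \<in> borel_measurable AM"
      using measurable_compose[OF measurable_Pair1'[OF s] bddD(1)[OF q]] .
    have ae: "AE a in AM. 0 \<le> \<pi> \<theta> s a" using pos by (auto intro: less_imp_le)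
    have "integrable (pol M \<pi> \<theta> s) (\<lambda>a. q (s, a))"
      using bddD(2)[OF q sa] by (rule integrable_bounded[OF policy_prob[OF pol_policies s] qm])
    then show ?thesis
      using integrable_density[OF qm pm ae] integral_density[OF qm pm ae] by (simp add: pol_def)
  qed
  have one: "integrable AM (\<lambda>a. \<pi> \<theta> s a) \<and> (\<integral>a. \<pi> \<theta> s a \<partial>AM) = 1"
  proof -
    interpret P: prob_space "pol M \<pi> \<theta> s" by (rule prob_algebraD[OF policy_prob[OF pol_policies s]])
    have "bdd 1 (\<lambda>_. 1)" by (simp add: bdd_def)
    from I[OF this, of \<theta>] show ?thesis by (simp add: P.prob_space)
  qed
  note F' = I[OF f, of \<theta>'] and F = I[OF f, of \<theta>] and KF = I[OF bdd_mult[OF k f], of \<theta>]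
  \<comment> \<open>\<open>bdd\<close> bounds values only at points of the space, so the sign of
    \<open>C\<close> requires an action; one exists because the policy has mass one.\<close>
  have C0: "0 \<le> C"
  proof -
    have "space AM \<noteq> {}"
      using prob_algebraD(1,3)[OF policy_prob[OF pol_policies s]] prob_space.not_empty by fastforce
    then show ?thesis using bddD(2)[OF f sa] by fastforce
  qed
  have "(\<integral>a. f (s, a) \<partial>pol M \<pi> \<theta>' s) - (\<integral>a. f (s, a) \<partial>pol M \<pi> \<theta> s)
    - (\<integral>a. k (s, a) * f (s, a) \<partial>pol M \<pi> \<theta> s) =
    (\<integral>a. \<pi> \<theta>' s a * f (s, a) - \<pi> \<theta> s a * f (s, a) - \<pi> \<theta> s a * (k (s, a) * f (s, a)) \<partial>AM)"
    using F' F KF by simp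
  also have "\<bar>\<dots>\<bar> \<le> (\<integral>a. \<bar>\<pi> \<theta>' s a * f (s, a) - \<pi> \<theta> s a * f (s, a) - \<pi> \<theta> s a * (k (s, a) * f (s, a))\<bar> \<partial>AM)"
    by (rule integral_abs_bound)
  also have "\<dots> \<le> (\<integral>a. (c * C) * \<pi> \<theta> s a \<partial>AM)"
  proof (rule integral_mono)
    fix a assume a: "a \<in> space AM"
    have "\<bar>\<pi> \<theta>' s a * f (s, a) - \<pi> \<theta> s a * f (s, a) - \<pi> \<theta> s a * (k (s, a) * f (s, a))\<bar>
      = \<bar>\<pi> \<theta>' s a - \<pi> \<theta> s a - \<pi> \<theta> s a * k (s, a)\<bar> * \<bar>f (s, a)\<bar>"
      unfolding abs_mult[symmetric] by (simp add: algebra_simps)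
    also have "\<dots> \<le> (c * \<pi> \<theta> s a) * C"
      using pert[OF a] bddD(2)[OF f sa[OF a]] by (intro mult_mono) auto
    finally show "\<bar>\<pi> \<theta>' s a * f (s, a) - \<pi> \<theta> s a * f (s, a) - \<pi> \<theta> s a * (k (s, a) * f (s, a))\<bar>
      \<le> (c * C) * \<pi> \<theta> s a" by (simp add: mult_ac)
  qed (use F' F KF one in auto)
  also have "\<dots> = c * C" using one by simp
  finally show ?thesis .
qed

section \<open>First-order expansion of a value in the policy parameter\<close>

definition value_at :: "('s \<times> 'a \<Rightarrow> real) \<Rightarrow> real ^ 'd \<Rightarrow> real" where
  "value_at g \<theta> = val (pol M \<pi> \<theta>) g (pair_law M (init M) (pol M \<pi> \<theta>))"

lemma J_fun_value_at: "J_fun M \<pi> = value_at rew"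
  by (simp add: fun_eq_iff J_fun_def value_at_def exp_return_val[OF pol_policies])

context
  fixes g B and \<theta> :: "real ^ 'd" assumes g: "bdd B g"
begin

abbreviation "A \<equiv> aval (pol M \<pi> \<theta>) g"
abbreviation "bA \<equiv> 2 * B / (1 - disc M)"

text \<open>The integrand is the advantage of \<open>\<theta>\<close> averaged under
  \<open>\<theta>'\<close>. Its average under \<open>\<theta>\<close> vanishes, so for nearby
  parameters only the change of the policy density contributes.\<close>

lemma value_difference:
  "value_at g \<theta>' - value_at g \<theta> =
    val (pol M \<pi> \<theta>') (\<lambda>z. \<integral>a. A (fst z, a) \<partial>pol M \<pi> \<theta>' (fst z)) (pair_law M (init M) (pol M \<pi> \<theta>'))"
  unfolding value_at_def performance_difference[OF pol_policies g pol_policies init]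
  by (rule val_average[OF pol_policies bdd_aval[OF pol_policies g]])

lemma average_advantage_zero: "s \<in> space SM \<Longrightarrow> (\<integral>a. A (s, a) \<partial>pol M \<pi> \<theta> s) = 0"
proof -
  assume s: "s \<in> space SM"
  note P = policy_prob[OF pol_policies s]
  interpret P: prob_space "pol M \<pi> \<theta> s" by (rule prob_algebraD[OF P])
  note q = bdd_qval[OF pol_policies g]
  have "integrable (pol M \<pi> \<theta> s) (\<lambda>a. qval (pol M \<pi> \<theta>) g (s, a))"
    using s bddD(2)[OF q]
    by (intro integrable_bounded[OF P measurable_compose[OF measurable_Pair1'[OF s] bddD(1)[OF q]]])
      (auto simp: space_pair_measure)
  then show ?thesis by (simp add: aval_def vval_def P.prob_space)
qed

lemma bdd_average:
  assumes k: "\<kappa> \<in> policies M" and f: "bdd C f"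
  shows "bdd C (\<lambda>z. \<integral>a. f (fst z, a) \<partial>\<kappa> (fst z))"
  unfolding bdd_def
proof (intro conjI ballI)
  show "(\<lambda>z. \<integral>a. f (fst z, a) \<partial>\<kappa> (fst z)) \<in> borel_measurable SA"
    using measurable_compose[OF measurable_fst policy_average_measurable[OF k bddD(1)[OF f]]] .
  show "\<bar>\<integral>a. f (fst z, a) \<partial>\<kappa> (fst z)\<bar> \<le> C" if "z \<in> space SA" for z
  proof -
    have s: "fst z \<in> space SM" using that by (auto simp: space_pair_measure)
    show ?thesis using s bddD(2)[OF f]
      by (intro integral_bounded[OF policy_prob[OF k s] measurable_compose[OF measurable_Pair1'[OF s] bddD(1)[OF f]]])
        (auto simp: space_pair_measure)
  qed
qed

text \<open>One factor \<open>1 / (1 - disc M)\<close> sits in \<open>bA\<close> as the size of the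
  advantage; the other sums the discounted series.\<close>

lemma value_Lipschitz:
  assumes h: "Mg * norm h \<le> 1"
  shows "\<bar>value_at g (\<theta> + h) - value_at g \<theta>\<bar> \<le> (2 * Mg * norm h) * bA / (1 - disc M)"
  unfolding value_difference
proof (rule val_bound[OF pol_policies pair_law_prob[OF init pol_policies]])
  note A = bdd_aval[OF pol_policies g, of \<theta>]
  have "\<bar>\<integral>a. A (s, a) \<partial>pol M \<pi> (\<theta> + h) s\<bar> \<le> (2 * Mg * norm h) * bA" if s: "s \<in> space SM" for s
    using policy_perturbation[OF s A, of 0 "\<lambda>_. 0" "\<theta> + h" \<theta> "2 * Mg * norm h"]
      policy_ratio_bound[OF _ h, of "(s, _)" \<theta>] s average_advantage_zero[OF s]
    by (auto simp: bdd_def space_pair_measure)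
  then show "bdd ((2 * Mg * norm h) * bA) (\<lambda>z. \<integral>a. A (fst z, a) \<partial>pol M \<pi> (\<theta> + h) (fst z))"
    using bddD(1)[OF bdd_average[OF pol_policies A, of "\<theta> + h"]] by (auto simp: bdd_def space_pair_measure)
qed

text \<open>The derivative in direction \<open>h\<close> of the action-averaged advantage with the
  advantage itself held fixed, in score form. It is again a bounded reward, so
  \<open>value_at\<close> applies to it.\<close>

definition slope :: "real ^ 'd \<Rightarrow> 's \<times> 'a \<Rightarrow> real" where
  "slope h z = (\<integral>a. (h \<bullet> score \<theta> (fst z, a)) * A (fst z, a) \<partial>pol M \<pi> \<theta> (fst z))"

lemma bdd_slope: "bdd (norm h * Mg * bA) (slope h)"
  unfolding slope_def[abs_def]
  by (rule bdd_average[OF pol_policies bdd_mult[OF bdd_score bdd_aval[OF pol_policies g]]])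

text \<open>\<open>value_difference\<close> runs under the new policy, so the linear term first
  appears as the value of \<open>slope h\<close> at \<open>\<theta> + h\<close>;
  \<open>value_GDERIV\<close> moves it back to \<open>\<theta>\<close>.\<close>

lemma value_Taylor_val:
  assumes h: "Mg * norm h \<le> 1"
  shows "\<bar>value_at g (\<theta> + h) - value_at g \<theta> - value_at (slope h) (\<theta> + h)\<bar>
    \<le> ((Mg\<^sup>2 + Mh) * (norm h)\<^sup>2) * bA / (1 - disc M)"
proof -
  note A = bdd_aval[OF pol_policies g, of \<theta>]
  note nu = pair_law_prob[OF init pol_policies, of "\<theta> + h"]
  note av = bdd_average[OF pol_policies A, of "\<theta> + h"]
  let ?c = "(Mg\<^sup>2 + Mh) * (norm h)\<^sup>2"
  let ?e = "\<lambda>z. (\<integral>a. A (fst z, a) \<partial>pol M \<pi> (\<theta> + h) (fst z)) - slope h z"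
  have "\<bar>(\<integral>a. A (s, a) \<partial>pol M \<pi> (\<theta> + h) s) - (\<integral>a. (h \<bullet> score \<theta> (s, a)) * A (s, a) \<partial>pol M \<pi> \<theta> s)\<bar> \<le> ?c * bA"
    if s: "s \<in> space SM" for s
    using policy_perturbation[OF s A bdd_score[of h \<theta>], of "\<theta> + h" \<theta> ?c]
      policy_ratio_Taylor[OF _ h, of "(s, _)" \<theta>] s average_advantage_zero[OF s]
    by (auto simp: space_pair_measure)
  then have "bdd (?c * bA) ?e"
    using bddD(1)[OF bdd_diff[OF av bdd_slope[of h]]] by (auto simp: bdd_def space_pair_measure slope_def)
  then show ?thesis
    unfolding value_difference
    unfolding value_at_def val_diff[OF pol_policies[of "\<theta> + h"] nu av bdd_slope, symmetric]
    by (rule val_bound[OF pol_policies nu])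
qed

text \<open>The derivative is \<open>value_at (slope h) \<theta>\<close>, linear in
  \<open>h\<close>. Moving from \<open>\<theta> + h\<close> back to \<open>\<theta>\<close> costs a
  Lipschitz factor of order \<open>norm h\<close> on a reward that is itself of order
  \<open>norm h\<close>, hence a quadratic error.\<close>

lemma value_GDERIV: "\<exists>D. GDERIV (value_at g) \<theta> :> D"
proof -
  note nu = pair_law_prob[OF init pol_policies, of \<theta>]
  let ?F = "\<lambda>h. value_at (slope h) \<theta>"
  have slope_add: "slope (h + h') z = slope h z + slope h' z" and slope_scale: "slope (c *\<^sub>R h) z = c * slope h z"
    if z: "z \<in> space SA" for h h' c z
  proof -
    have s: "fst z \<in> space SM" using z by (auto simp: space_pair_measure)
    have i: "integrable (pol M \<pi> \<theta> (fst z)) (\<lambda>a. (h \<bullet> score \<theta> (fst z, a)) * A (fst z, a))" for h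
      using bddD[OF bdd_mult[OF bdd_score[of h \<theta>] bdd_aval[OF pol_policies g, of \<theta>]]] s
      by (intro integrable_bounded[OF policy_prob[OF pol_policies s] measurable_compose[OF measurable_Pair1'[OF s]]])
        (auto simp: space_pair_measure)
    show "slope (h + h') z = slope h z + slope h' z"
      using i[of h] i[of h'] by (simp add: slope_def inner_add_left distrib_right)
    show "slope (c *\<^sub>R h) z = c * slope h z"
      by (simp add: slope_def mult.assoc)
  qed
  have "linear ?F"
  proof (rule linearI)
    show "?F (h + h') = ?F h + ?F h'" for h h'
      unfolding value_at_def val_add[OF pol_policies nu bdd_slope bdd_slope, symmetric]
      by (rule val_cong[OF pol_policies nu]) (rule slope_add)
    show "?F (c *\<^sub>R h) = c *\<^sub>R ?F h" for c h
      unfolding value_at_def real_scaleR_def val_scale[OF pol_policies nu bdd_slope, symmetric]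
      by (rule val_cong[OF pol_policies nu]) (rule slope_scale)
  qed
  then have bl: "bounded_linear ?F" by (simp add: linear_conv_bounded_linear)
  \<comment> \<open>Sum of the coefficients from \<open>value_Taylor_val\<close> and from
    \<open>value_Lipschitz\<close> for the reward \<open>slope h\<close>, whose bound is
    \<open>norm h * Mg * bA\<close>.\<close>
  define c where "c = ((Mg\<^sup>2 + Mh) * bA + 4 * Mg\<^sup>2 * bA / (1 - disc M)) / (1 - disc M)"
  have err: "\<bar>value_at g (\<theta> + h) - value_at g \<theta> - ?F h\<bar> \<le> c * (norm h)\<^sup>2" if h: "Mg * norm h \<le> 1" for h
  proof -
    have "\<bar>value_at (slope h) (\<theta> + h) - ?F h\<bar>
      \<le> (2 * Mg * norm h) * (2 * (norm h * Mg * bA) / (1 - disc M)) / (1 - disc M)"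
      using policy_class.value_Lipschitz[OF policy_class_axioms bdd_slope h] .
    moreover note value_Taylor_val[OF h]
    moreover have "c * (norm h)\<^sup>2 = ((Mg\<^sup>2 + Mh) * (norm h)\<^sup>2) * bA / (1 - disc M) +
        (2 * Mg * norm h) * (2 * (norm h * Mg * bA) / (1 - disc M)) / (1 - disc M)"
      by (simp add: c_def divide_inverse algebra_simps power2_eq_square)
    ultimately show ?thesis by linarith
  qed
  have "(value_at g has_derivative ?F) (at \<theta>)"
  \<comment> \<open>The radius \<open>1 / Mg\<close> is the range in which the density ratio
    estimates hold.\<close>
  proof (rule has_derivativeI_sandwich[where e="1 / Mg" and H="\<lambda>y. c * norm (y - \<theta>)"])
    show "0 < 1 / Mg" using Mg_pos by simp
    show "bounded_linear ?F" by fact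
    show "((\<lambda>y. c * norm (y - \<theta>)) \<longlongrightarrow> 0) (at \<theta>)"
      by (auto intro!: tendsto_eq_intros)
    fix y assume y: "y \<noteq> \<theta>" "dist y \<theta> < 1 / Mg"
    then have "Mg * norm (y - \<theta>) \<le> 1" using Mg_pos by (simp add: dist_norm field_simps)
    from err[OF this] show "norm (value_at g y - value_at g \<theta> - ?F (y - \<theta>)) / norm (y - \<theta>) \<le> c * norm (y - \<theta>)"
      using y(1) by (simp add: divide_le_eq power2_eq_square mult.assoc)
  qed
  then have "value_at g differentiable (at \<theta>)" by (auto simp: differentiable_def)
  from GDERIV_grad[OF this] show ?thesis by blast
qed

end

end

section \<open>Optimality gap\<close>

text \<open>Coercivity makes \<open>F\<close> injective, hence invertible, and the Penrose equations
  then force \<open>pinv F\<close> to be the inverse. The bound follows by testing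
  \<open>F *v w = g\<close> against \<open>w\<close> itself.\<close>

lemma norm_pinv_le:
  fixes F :: "real ^ 'd ^ 'd"
  assumes F: "loewner_ge F (\<mu> *\<^sub>R mat 1)" and mu: "0 < \<mu>"
  shows "norm (pinv F *v g) \<le> norm g / \<mu>"
proof -
  have pos: "\<mu> * (norm v)\<^sup>2 \<le> v \<bullet> (F *v v)" for v
  proof -
    have "0 \<le> v \<bullet> ((F - \<mu> *\<^sub>R mat 1) *v v)" using F by (simp add: loewner_ge_def)
    then show ?thesis
      by (simp add: matrix_vector_mult_diff_rdistrib inner_diff_right scaleR_matrix_vector_assoc[symmetric]
          power2_norm_eq_inner)
  qed
  have "v = 0" if "F *v v = 0" for v
  proof -
    have "\<mu> * (norm v)\<^sup>2 \<le> 0" using pos[of v] that by simp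
    then show ?thesis using mu by (simp add: mult_le_0_iff)
  qed
  then have "\<exists>G. G ** F = mat 1"
    by (simp add: matrix_left_invertible_ker)
  then obtain G where G: "G ** F = mat 1" "F ** G = mat 1"
    using matrix_left_right_inverse by blast
  have "pinv F = G"
    unfolding pinv_def
  proof (rule the_equality)
    show "F ** G ** F = F \<and> G ** F ** G = G \<and> transpose (F ** G) = F ** G \<and> transpose (G ** F) = G ** F"
      by (simp add: G)
    fix Y assume "F ** Y ** F = F \<and> Y ** F ** Y = Y \<and> transpose (F ** Y) = F ** Y \<and> transpose (Y ** F) = Y ** F"
    then have "G ** (F ** Y ** F) ** G = G ** F ** G" by simp
    then have "(G ** F) ** Y ** (F ** G) = (G ** F) ** G" by (simp only: matrix_mul_assoc)
    then show "Y = G" by (simp add: G)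
  qed
  then have Fw: "F *v (pinv F *v g) = g"
    by (simp add: matrix_vector_mul_assoc G)
  let ?w = "pinv F *v g"
  have "\<mu> * (norm ?w)\<^sup>2 \<le> norm ?w * norm g"
    using pos[of ?w] norm_cauchy_schwarz[of ?w g] by (simp add: Fw)
  then have "norm ?w * (\<mu> * norm ?w) \<le> norm ?w * norm g" by (simp add: power2_eq_square mult_ac)
  then show ?thesis
    using mu by (cases "norm ?w = 0") (auto simp: field_simps)
qed

text \<open>A quantitative form of Ekeland's principle: minimise \<open>J\<close> plus a small quadratic
  penalty around \<open>x\<^sub>0\<close>.\<close>

lemma almost_critical_below:
  fixes J :: "'v::euclidean_space \<Rightarrow> real"
  assumes diff: "\<And>x. J differentiable (at x)" and bound: "\<And>x. \<bar>J x\<bar> \<le> B" and B: "0 < B" and e: "0 < e"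
  shows "\<exists>x. J x \<le> J x\<^sub>0 \<and> norm (grad J x) \<le> e"
proof -
  \<comment> \<open>Chosen so that the final bound \<open>4 * \<delta> * (2 * B)\<close> on the
    squared gradient equals \<open>e\<^sup>2\<close>.\<close>
  define \<delta> where "\<delta> = e\<^sup>2 / (8 * B)"
  have d: "0 < \<delta>" using B e by (simp add: \<delta>_def)
  \<comment> \<open>The penalty at a minimiser is at most \<open>2 * B\<close>, the largest possible
    oscillation of \<open>J\<close>, while on the sphere of radius \<open>R\<close> it equals
    \<open>2 * B + 1\<close>. So the minimiser is interior and the derivative vanishes
    there.\<close>
  define R where "R = sqrt ((2 * B + 1) / \<delta>)"
  have R2: "\<delta> * R\<^sup>2 = 2 * B + 1" and R: "0 < R" using d B by (auto simp: R_def)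
  let ?\<phi> = "\<lambda>x. J x + \<delta> * ((x - x\<^sub>0) \<bullet> (x - x\<^sub>0))"
  have "continuous_on UNIV J"
    using diff by (auto simp: differentiable_on_def intro!: differentiable_imp_continuous_on differentiable_at_withinI)
  then have "continuous_on (cball x\<^sub>0 R) ?\<phi>"
    by (intro continuous_intros) (auto intro: continuous_on_subset)
  then obtain x where x: "x \<in> cball x\<^sub>0 R" "\<And>y. y \<in> cball x\<^sub>0 R \<Longrightarrow> ?\<phi> x \<le> ?\<phi> y"
    using continuous_attains_inf[of "cball x\<^sub>0 R" ?\<phi>] R by auto
  have le: "J x + \<delta> * (norm (x - x\<^sub>0))\<^sup>2 \<le> J x\<^sub>0"
    using x(2)[of x\<^sub>0] R by (simp add: power2_norm_eq_inner)
  then have pen: "\<delta> * (norm (x - x\<^sub>0))\<^sup>2 \<le> 2 * B" using bound[of x] bound[of x\<^sub>0] by linarith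
  then have "\<delta> * (norm (x - x\<^sub>0))\<^sup>2 < \<delta> * R\<^sup>2" using R2 by simp
  then have "(norm (x - x\<^sub>0))\<^sup>2 < R\<^sup>2" using d by simp
  then have inner: "x \<in> ball x\<^sub>0 R" using R by (simp add: dist_norm norm_minus_commute power2_less_imp_less)
  have "(?\<phi> has_derivative (\<lambda>h. h \<bullet> grad J x + \<delta> * ((x - x\<^sub>0) \<bullet> h + h \<bullet> (x - x\<^sub>0)))) (at x)"
    using GDERIV_grad[OF diff, of x] unfolding gderiv_def
    by (auto intro!: derivative_eq_intros)
  moreover have "\<forall>\<^sub>F y in at x. ?\<phi> x \<le> ?\<phi> y"
    using eventually_at_in_open'[OF open_ball inner] x(2) by (auto elim!: eventually_mono)
  ultimately have "(\<lambda>h. h \<bullet> grad J x + \<delta> * ((x - x\<^sub>0) \<bullet> h + h \<bullet> (x - x\<^sub>0))) = (\<lambda>h. 0)"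
    by (rule has_derivative_local_min)
  then have "h \<bullet> grad J x + \<delta> * ((x - x\<^sub>0) \<bullet> h + h \<bullet> (x - x\<^sub>0)) = 0" for h by meson
  then have "h \<bullet> (grad J x + (2 * \<delta>) *\<^sub>R (x - x\<^sub>0)) = 0" for h
    by (simp add: inner_add_right inner_commute mult_ac)
  then have "grad J x + (2 * \<delta>) *\<^sub>R (x - x\<^sub>0) = 0" by (metis inner_eq_zero_iff)
  then have "grad J x = - ((2 * \<delta>) *\<^sub>R (x - x\<^sub>0))" by (simp add: eq_neg_iff_add_eq_0)
  then have "norm (grad J x) = 2 * \<delta> * norm (x - x\<^sub>0)" using d by simp
  then have "(norm (grad J x))\<^sup>2 = 4 * \<delta> * (\<delta> * (norm (x - x\<^sub>0))\<^sup>2)" by (simp add: power2_eq_square)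
  also have "\<dots> \<le> 4 * \<delta> * (2 * B)" using pen d by (intro mult_left_mono) auto
  also have "\<dots> = e\<^sup>2" using B by (simp add: \<delta>_def)
  finally have "norm (grad J x) \<le> e" using less_imp_le[OF e] by (rule power2_le_imp_le)
  moreover have "J x \<le> J x\<^sub>0"
  proof -
    have "0 \<le> \<delta> * (norm (x - x\<^sub>0))\<^sup>2" using d by simp
    with le show ?thesis by linarith
  qed
  ultimately show ?thesis by blast
qed

context policy_class
begin

lemma J_differentiable: "J_fun M \<pi> differentiable (at \<theta>)"
proof -
  obtain D where "GDERIV (J_fun M \<pi>) \<theta> :> D"
    using value_GDERIV[OF bdd_reward] unfolding J_fun_value_at by blast
  then show ?thesis unfolding gderiv_def differentiable_def by blast
qed

lemma J_bound: "\<bar>J_fun M \<pi> \<theta>\<bar> \<le> rmax M / (1 - disc M)"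
  unfolding J_fun_value_at value_at_def
  by (rule val_bound[OF pol_policies pair_law_prob[OF init pol_policies] bdd_reward])

lemma J_measurable: "J_fun M \<pi> \<in> borel_measurable borel"
  using J_differentiable
  by (intro borel_measurable_continuous_onI differentiable_imp_continuous_on)
     (auto simp: differentiable_on_def intro: differentiable_at_withinI)

context
  fixes \<kappa> \<mu>F \<epsilon>b
  assumes k: "\<kappa> \<in> policies M" and fisher: "fisher_nondegenerate M \<pi> \<mu>F"
    and compat: "compatible M \<pi> \<kappa> \<epsilon>b"
begin

text \<open>Up to the factor \<open>1 - disc M\<close>, the gap is the mean advantage under the
  visitation of \<open>\<kappa>\<close>. The advantage splits into the linear part
  \<open>?S\<close>, controlled by \<open>norm w\<close> and the score bound, and a residual whose
  second moment is the transfer error. The factor \<open>1 - disc M\<close> in \<open>?S\<close>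
  cancels the normalisation of the visitation.\<close>

lemma gradient_domination:
  "exp_return M \<kappa> - J_fun M \<pi> \<theta> \<le> sqrt \<epsilon>b / (1 - disc M) + Mg / \<mu>F * norm (grad (J_fun M \<pi>) \<theta>)"
proof -
  let ?K = "pol M \<pi> \<theta>" and ?P = "pair_law M (visit M \<kappa>) \<kappa>"
  define w where "w = w_star M \<pi> \<theta>"
  let ?A = "aval ?K rew" and ?S = "\<lambda>z. (1 - disc M) * (w \<bullet> score \<theta> z)"
  note A = bdd_aval[OF pol_policies bdd_reward, of \<theta>]
  have S: "bdd ((1 - disc M) * (norm w * Mg)) ?S"
    using bdd_scale[OF bdd_score[of w \<theta>], of "1 - disc M"] disc by simp
  note X = bdd_diff[OF A S]
  note P = pair_law_prob[OF visit_prob[OF k] k]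
  interpret P: prob_space ?P by (rule prob_algebraD[OF P])
  note iA = integrable_bounded[OF P bddD[OF A]] and iS = integrable_bounded[OF P bddD[OF S]]
    and iX = integrable_bounded[OF P bddD[OF X]]
  have iX2: "integrable ?P (\<lambda>z. (?A z - ?S z)\<^sup>2)"
    using integrable_bounded[OF P bddD[OF bdd_mult[OF X X]]] by (simp add: power2_eq_square)
  \<comment> \<open>Jensen's inequality for the square, as non-negativity of the variance.\<close>
  have "(\<integral>z. ?A z - ?S z \<partial>?P)\<^sup>2 \<le> (\<integral>z. (?A z - ?S z)\<^sup>2 \<partial>?P)"
    using P.variance_positive[of "\<lambda>z. ?A z - ?S z"] P.variance_eq[OF iX iX2] by simp
  also have "\<dots> = transfer_error M \<pi> \<kappa> \<theta>"
    unfolding transfer_error_def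
    by (rule Bochner_Integration.integral_cong[OF refl])
       (simp add: prob_algebraD(3)[OF P] adv_aval[OF pol_policies] w_def score_def)
  also have "\<dots> \<le> \<epsilon>b" using compat by (simp add: compatible_def)
  finally have X_le: "(\<integral>z. ?A z - ?S z \<partial>?P) \<le> sqrt \<epsilon>b" by (rule real_le_rsqrt)
  have S_le: "(\<integral>z. ?S z \<partial>?P) \<le> (1 - disc M) * (norm w * Mg)"
    using integral_bounded[OF P bddD[OF S]] by linarith
  have "(1 - disc M) * (exp_return M \<kappa> - J_fun M \<pi> \<theta>) = (\<integral>z. ?A z \<partial>?P)"
    using performance_difference[OF pol_policies bdd_reward k init, of \<theta>] integral_visit[OF k A]
    by (simp add: exp_return_val[OF k] J_fun_value_at value_at_def)
  also have "\<dots> = (\<integral>z. ?A z - ?S z \<partial>?P) + (\<integral>z. ?S z \<partial>?P)"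
    using iA iS by simp
  also have "\<dots> \<le> sqrt \<epsilon>b + (1 - disc M) * (norm w * Mg)" using X_le S_le by linarith
  finally have "exp_return M \<kappa> - J_fun M \<pi> \<theta> \<le> sqrt \<epsilon>b / (1 - disc M) + norm w * Mg"
    using disc by (simp add: field_simps)
  moreover have "norm w \<le> norm (grad (J_fun M \<pi>) \<theta>) / \<mu>F"
    unfolding w_def w_star_def using fisher by (intro norm_pinv_le) (auto simp: fisher_nondegenerate_def)
  then have "norm w * Mg \<le> norm (grad (J_fun M \<pi>) \<theta>) / \<mu>F * Mg"
    using Mg_pos by (intro mult_right_mono) auto
  ultimately show ?thesis by (simp add: mult.commute)
qed

text \<open>No parameter is worse than the bias: below every \<open>\<theta>\<close> there are almost critical points,
  and gradient domination bounds the gap at those.\<close>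

lemma gap_le_bias: "exp_return M \<kappa> - J_fun M \<pi> \<theta> \<le> sqrt \<epsilon>b / (1 - disc M)"
proof (rule field_le_epsilon)
  fix e :: real assume e: "0 < e"
  have mu: "0 < \<mu>F" using fisher by (simp add: fisher_nondegenerate_def)
  \<comment> \<open>The tolerance for which the gradient term of the domination bound contributes
    exactly \<open>e\<close>.\<close>
  have "0 < e * \<mu>F / Mg" using e mu Mg_pos by simp
  then obtain \<theta>' where t: "J_fun M \<pi> \<theta>' \<le> J_fun M \<pi> \<theta>" "norm (grad (J_fun M \<pi>) \<theta>') \<le> e * \<mu>F / Mg"
    using almost_critical_below[OF J_differentiable J_bound] rmax disc by (metis diff_gt_0_iff_gt divide_pos_pos)
  have "Mg / \<mu>F * norm (grad (J_fun M \<pi>) \<theta>') \<le> Mg / \<mu>F * (e * \<mu>F / Mg)"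
    using t(2) mu Mg_pos by (intro mult_left_mono) auto
  also have "\<dots> = e" using mu Mg_pos by simp
  finally show "exp_return M \<kappa> - J_fun M \<pi> \<theta> \<le> sqrt \<epsilon>b / (1 - disc M) + e"
    using gradient_domination[of \<theta>'] t(1) by linarith
qed

end

section \<open>Law of the iterates\<close>

text \<open>Composing random iterations by bind calls for kernels measurable in the iterate. The
  finite trajectory law is itself an iterated bind, and the policy parameter is carried through each
  stage as an extra argument.\<close>

lemma traj_upto_kernel:
  "(\<lambda>\<theta>. traj_upto M (pol M \<pi> \<theta>) n) \<in> borel \<rightarrow>\<^sub>M prob_algebra (PiM {0..<n} (\<lambda>_. SA))"
proof -
  let ?P = "\<lambda>\<theta>. step_kernel M (pol M \<pi> \<theta>) (pair_law M (init M) (pol M \<pi> \<theta>))"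
  have IT: "Ionescu_Tulcea (?P \<theta>) (\<lambda>_. SA)" for \<theta>
    by (rule Ionescu_Tulcea_step_kernel[OF pol_policies pair_law_prob[OF init pol_policies]])
  have P: "(\<lambda>(\<theta>, \<omega>). ?P \<theta> m \<omega>) \<in> borel \<Otimes>\<^sub>M PiM {0..<m} (\<lambda>_. SA) \<rightarrow>\<^sub>M prob_algebra SA" for m
  proof -
    let ?L = "borel \<Otimes>\<^sub>M PiM {0..<m} (\<lambda>_. SA)"
    have pk: "(\<lambda>(x, s). pol M \<pi> (fst x) s) \<in> ?L \<Otimes>\<^sub>M SM \<rightarrow>\<^sub>M prob_algebra AM"
      using measurable_compose[of "\<lambda>y. (fst (fst y), snd y)", OF _ pol_kernel_joint] by (simp add: split_beta')
    show ?thesis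
    proof (cases m)
      case 0
      have "(\<lambda>x. pair_law M (init M) (pol M \<pi> (fst x))) \<in> ?L \<rightarrow>\<^sub>M prob_algebra SA"
        using init by (intro pair_law_kernel[OF _ pk]) simp
      then show ?thesis by (simp add: 0 step_kernel_def split_beta')
    next
      case (Suc j)
      have "(\<lambda>x. next_state M (snd x j)) \<in> ?L \<rightarrow>\<^sub>M prob_algebra SM"
        by (rule measurable_compose[where N=SA, OF _ next_state_kernel]) (simp add: Suc)
      from pair_law_kernel[OF this pk] show ?thesis
        by (simp add: Suc step_kernel_def split_beta')
    qed
  qed
  have "(\<lambda>\<theta>. Ionescu_Tulcea.C (?P \<theta>) (\<lambda>_. SA) 0 n (\<lambda>_. undefined))
      \<in> borel \<rightarrow>\<^sub>M prob_algebra (PiM {0..<n} (\<lambda>_. SA))"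
  proof (induction n)
    case 0
    have "return (PiM {0..<0::nat} (\<lambda>_. SA)) (\<lambda>_. undefined) \<in> space (prob_algebra (PiM {0..<0} (\<lambda>_. SA)))"
      by (rule return_in_prob_algebra) (simp add: space_PiM)
    then show ?case by (simp add: Ionescu_Tulcea.C.simps(1)[OF IT])
  next
    case (Suc m)
    have "(\<lambda>y. (snd (fst y))(m := snd y)) \<in> (borel \<Otimes>\<^sub>M PiM {0..<m} (\<lambda>_. SA)) \<Otimes>\<^sub>M SA
        \<rightarrow>\<^sub>M PiM {0..<Suc m} (\<lambda>_. SA)"
      by (rule measurable_fun_upd[where J="{0..<m}"]) auto
    then have "(\<lambda>x. distr (?P (fst x) m (snd x)) (PiM {0..<Suc m} (\<lambda>_. SA)) (fun_upd (snd x) m))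
        \<in> borel \<Otimes>\<^sub>M PiM {0..<m} (\<lambda>_. SA) \<rightarrow>\<^sub>M prob_algebra (PiM {0..<Suc m} (\<lambda>_. SA))"
      using P[of m] by (intro measurable_distr_prob_space2[where M=SA]) (auto simp: split_beta')
    then have "(\<lambda>(\<theta>, \<omega>). Ionescu_Tulcea.eP (?P \<theta>) (\<lambda>_. SA) m \<omega>)
        \<in> borel \<Otimes>\<^sub>M PiM {0..<m} (\<lambda>_. SA) \<rightarrow>\<^sub>M prob_algebra (PiM {0..<Suc m} (\<lambda>_. SA))"
      by (simp add: Ionescu_Tulcea.eP_def[OF IT] split_beta')
    from measurable_bind_prob_space2[OF Suc.IH this] show ?case
      by (simp add: Ionescu_Tulcea.C.simps(2)[OF IT])
  qed
  then show ?thesis by (simp add: traj_upto_def)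
qed

text \<open>Extrapolation, direction and update are separated so that each is measurable jointly in
  the iterate and the sampled trajectory; the step is then the push-forward of a measurable
  kernel.\<close>

lemma igt_step_kernel:
  "igt_step M \<pi> H \<eta> \<alpha> t \<in> borel \<rightarrow>\<^sub>M prob_algebra borel"
proof -
  let ?T = "PiM {0..<H} (\<lambda>_. SA)"
  define ext where "ext x = fst (snd x) + ((1 - \<eta> t) / \<eta> t) *\<^sub>R (fst (snd x) - fst x)"
    for x :: "(real ^ 'd) \<times> (real ^ 'd) \<times> (real ^ 'd)"
  define dir where "dir x \<tau> = (1 - \<eta> t) *\<^sub>R snd (snd x) + \<eta> t *\<^sub>R grad_est M \<pi> H \<tau> (ext x)"
    for x :: "(real ^ 'd) \<times> (real ^ 'd) \<times> (real ^ 'd)" and \<tau> :: "nat \<Rightarrow> 's \<times> 'a"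
  define upd where "upd x \<tau> = (fst (snd x), if dir x \<tau> = 0 then fst (snd x)
      else fst (snd x) + (\<alpha> t / norm (dir x \<tau>)) *\<^sub>R dir x \<tau>, dir x \<tau>)"
    for x :: "(real ^ 'd) \<times> (real ^ 'd) \<times> (real ^ 'd)" and \<tau> :: "nat \<Rightarrow> 's \<times> 'a"
  have step: "igt_step M \<pi> H \<eta> \<alpha> t = (\<lambda>x. distr (traj_upto M (pol M \<pi> (ext x)) H) borel (upd x))"
    by (simp add: fun_eq_iff igt_step_def ext_def upd_def[abs_def] dir_def Let_def split: prod.splits cong: if_cong)
  have ext [measurable]: "ext \<in> borel \<rightarrow>\<^sub>M borel"
    unfolding ext_def[abs_def] by (intro borel_measurable_continuous_onI continuous_intros)
  have [measurable]: "(\<lambda>x :: (real ^ 'd) \<times> (real ^ 'd) \<times> (real ^ 'd). fst (snd x)) \<in> borel \<rightarrow>\<^sub>M borel"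
    "(\<lambda>x :: (real ^ 'd) \<times> (real ^ 'd) \<times> (real ^ 'd). snd (snd x)) \<in> borel \<rightarrow>\<^sub>M borel"
    by (intro borel_measurable_continuous_onI continuous_intros)+
  have comp [measurable]: "(\<lambda>y. snd y h) \<in> borel \<Otimes>\<^sub>M ?T \<rightarrow>\<^sub>M SA" if "h < H" for h
    using that by simp
  have rw: "(\<lambda>y. reward M (fst (snd y h)) (snd (snd y h))) \<in> borel_measurable (borel \<Otimes>\<^sub>M ?T)" if "h < H" for h
    using measurable_compose[OF comp[OF that] reward_measurable] .
  have sc: "(\<lambda>y. score (ext (fst y)) (snd y h)) \<in> borel_measurable (borel \<Otimes>\<^sub>M ?T)" if "h < H" for h
  proof -
    have "(\<lambda>y. (ext (fst y), snd y h)) \<in> borel \<Otimes>\<^sub>M ?T \<rightarrow>\<^sub>M borel \<Otimes>\<^sub>M SA"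
      using comp[OF that] by measurable
    from measurable_compose[OF this score_joint] show ?thesis by simp
  qed
  have "(\<lambda>y. grad_est M \<pi> H (snd y) (ext (fst y))) \<in> borel_measurable (borel \<Otimes>\<^sub>M ?T)"
    unfolding grad_est_def score_def[symmetric]
    by (intro borel_measurable_sum borel_measurable_scaleR borel_measurable_times borel_measurable_const rw sc) auto
  then have [measurable]: "(\<lambda>y. dir (fst y) (snd y)) \<in> borel_measurable (borel \<Otimes>\<^sub>M ?T)"
    unfolding dir_def by measurable
  have "(\<lambda>y. upd (fst y) (snd y)) \<in> borel_measurable (borel \<Otimes>\<^sub>M ?T)"
    unfolding upd_def by measurable
  then show ?thesis
    unfolding step
    by (intro measurable_distr_prob_space2[where M="?T"] measurable_compose[OF ext traj_upto_kernel])
       (simp add: split_beta')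
qed

lemma igt_law_prob: "igt_law M \<pi> H \<eta> \<alpha> \<theta>0 \<theta>1 d0 n \<in> space (prob_algebra borel)"
  by (induction n) (auto intro: return_in_prob_algebra bind_in_prob_algebra igt_step_kernel)

text \<open>The output law is a probability measure, so a lower bound valid at every parameter
  survives the expectation.\<close>

lemma igt_value_ge:
  assumes "\<And>\<theta>. c \<le> J_fun M \<pi> \<theta>"
  shows "c \<le> igt_value M \<pi> H \<eta> \<alpha> \<theta>0 \<theta>1 d0 T"
proof -
  define n where "n = T - 1"
  let ?P = "igt_law M \<pi> H \<eta> \<alpha> \<theta>0 \<theta>1 d0 n"
  interpret P: prob_space ?P by (rule prob_algebraD[OF igt_law_prob])
  have "(\<lambda>x :: (real ^ 'd) \<times> (real ^ 'd) \<times> (real ^ 'd). fst (snd x)) \<in> borel \<rightarrow>\<^sub>M borel"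
    by (intro borel_measurable_continuous_onI continuous_intros)
  from measurable_compose[OF this J_measurable]
  have "(\<lambda>x :: (real ^ 'd) \<times> (real ^ 'd) \<times> (real ^ 'd). J_fun M \<pi> (fst (snd x))) \<in> borel_measurable borel" .
  from integrable_bounded[OF igt_law_prob this J_bound]
  have "integrable ?P (\<lambda>x. J_fun M \<pi> (fst (snd x)))" .
  then have "(\<integral>x. c \<partial>?P) \<le> (\<integral>x. J_fun M \<pi> (fst (snd x)) \<partial>?P)"
    by (intro integral_mono P.integrable_const assms) auto
  then show ?thesis unfolding igt_value_def n_def[symmetric] by (simp add: P.prob_space)
qed

end

section \<open>Convergence rate and sample complexity\<close>

text \<open>The number of iterations is polynomial in \<open>1 / \<epsilon>\<close>, so its
  logarithm is a multiple of \<open>ln (2 + 1 / \<epsilon>)\<close>. The constant 4 is 3 from a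
  cubic bound on \<open>T + 1\<close> plus 1 for rounding the horizon up.\<close>

lemma sample_count_bound:
  fixes \<epsilon> \<gamma> :: real
  assumes e: "0 < \<epsilon>" and g: "0 < \<gamma>" "\<gamma> < 1"
  shows "real (sample_count \<gamma> (max 1 (nat \<lceil>\<epsilon> powr (- (5 / 2))\<rceil>)))
    \<le> 4 / (1 - \<gamma>) * \<epsilon> powr (- (5 / 2)) * ln (2 + 1 / \<epsilon>)"
proof -
  define x where "x = \<epsilon> powr (- (5 / 2))"
  have x: "0 < x" using e by (simp add: x_def)
  define T where "T = max 1 (nat \<lceil>x\<rceil>)"
  \<comment> \<open>The offset 2 makes the argument at least 3, hence at least \<open>exp 1\<close>,
    so the logarithm can absorb the rounding of the horizon.\<close>
  have ln3: "1 \<le> ln (2 + 1 / \<epsilon>)" if "\<epsilon> \<le> 1"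
  proof -
    have "exp 1 \<le> 2 + 1 / \<epsilon>"
      using exp_le that e by (smt (verit) le_divide_eq_1_pos)
    then show ?thesis using e by (subst ln_ge_iff) (auto intro: add_pos_pos)
  qed
  show ?thesis
  proof (cases "\<epsilon> < 1")
    \<comment> \<open>Here \<open>T = 1\<close>: the initial iterate is the output and nothing is
      sampled.\<close>
    case False
    then have "x \<le> 1" using e powr_mono[of "- (5 / 2)" 0 \<epsilon>] by (simp add: x_def)
    then have "T = 1" using x by (simp add: T_def)
    then have "sample_count \<gamma> T = 0" by (simp add: sample_count_def)
    moreover have "0 \<le> ln (2 + 1 / \<epsilon>)" using e by (simp add: add_increasing2)
    ultimately show ?thesis using g by (simp add: T_def x_def)
  next
    case True
    let ?l = "ln (2 + 1 / \<epsilon>)"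
    have x1: "1 < x" using True e powr_less_mono2[of "5 / 2" \<epsilon> 1]
      by (simp add: x_def powr_minus_divide)
    then have T: "real T \<le> x + 1" "real (T - 1) \<le> x" "1 \<le> T" by (auto simp: T_def) linarith+
    \<comment> \<open>Raising the exponent from 5/2 to 3 gives an integer power, and the offset in
      \<open>2 + 1 / \<epsilon>\<close> then absorbs both the rounding of \<open>T\<close> and the
      added one.\<close>
    have "x \<le> (1 / \<epsilon>) ^ 3"
    proof -
      have "x = (1 / \<epsilon>) powr (5 / 2)" using e by (simp add: x_def powr_minus_divide powr_divide)
      also have "\<dots> \<le> (1 / \<epsilon>) powr 3" using True e by (intro powr_mono) auto
      also have "\<dots> = (1 / \<epsilon>) ^ 3" using e by (intro powr_numeral) simp
      finally show ?thesis .
    qed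
    moreover have "(1 / \<epsilon>) ^ 3 + 2 \<le> (2 + 1 / \<epsilon>) ^ 3"
    proof -
      define y where "y = 1 / \<epsilon>"
      have "0 < y" using e by (simp add: y_def)
      moreover have "(2 + y) ^ 3 = y ^ 3 + 8 + 12 * y + 6 * y\<^sup>2"
        by (simp add: power3_eq_cube power2_eq_square algebra_simps)
      ultimately show ?thesis unfolding y_def[symmetric] by simp
    qed
    ultimately have "real T + 1 \<le> (2 + 1 / \<epsilon>) ^ 3" using T(1) by linarith
    then have "ln (real T + 1) \<le> ln ((2 + 1 / \<epsilon>) ^ 3)"
      using e by (subst ln_le_cancel_iff) (simp_all add: add_pos_pos)
    also have "\<dots> = 3 * ?l" using e by (simp add: ln_realpow add_pos_pos)
    finally have lT: "ln (real T + 1) \<le> 3 * ?l" .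
    have "real (horizon \<gamma> T) \<le> ln (real T + 1) / (1 - \<gamma>) + 1"
    proof -
      have "0 \<le> ln (real T + 1) / (1 - \<gamma>)" using g by simp
      then show ?thesis unfolding horizon_def by linarith
    qed
    also have "\<dots> \<le> 3 * ?l / (1 - \<gamma>) + ?l / (1 - \<gamma>)"
    proof (rule add_mono)
      show "ln (real T + 1) / (1 - \<gamma>) \<le> 3 * ?l / (1 - \<gamma>)" using lT g by (intro divide_right_mono) auto
      show "1 \<le> ?l / (1 - \<gamma>)" using ln3 True g by (simp add: le_divide_eq)
    qed
    finally have h: "real (horizon \<gamma> T) \<le> 4 / (1 - \<gamma>) * ?l" by (simp add: field_simps)
    have "real (sample_count \<gamma> T) \<le> x * (4 / (1 - \<gamma>) * ?l)"
      unfolding sample_count_def of_nat_mult using T(2) h x by (intro mult_mono) auto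
    then show ?thesis by (simp add: T_def x_def mult_ac)
  qed
qed

lemma rate_nonneg:
  assumes "0 < R" "0 < \<gamma>" "\<gamma> < 1" "0 < Mg" "0 < Mh"
  shows "0 \<le> sigma_g R \<gamma> Mg" "0 \<le> L_h R \<gamma> Mg Mh l2"
proof -
  show "0 \<le> sigma_g R \<gamma> Mg" using assms by (simp add: sigma_g_def)
  \<comment> \<open>One positive member of the set settles the sign of the maximum.\<close>
  have "Mh \<le> Max {Mh, \<gamma> * Mg\<^sup>2 / (1 - \<gamma>), l2 / Mg, Mh * \<gamma> / (1 - \<gamma>),
            (Mg * (1 + \<gamma>) + Mh * \<gamma> * (1 - \<gamma>)) / (1 - \<gamma>\<^sup>2)}" by (rule Max_ge) auto
  then show "0 \<le> L_h R \<gamma> Mg Mh l2"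
    unfolding L_h_def using assms by (intro add_nonneg_nonneg mult_nonneg_nonneg divide_nonneg_nonneg) auto
qed

theorem theorem1:
  "\<exists>C1 C2 C3. absolute_constant C1 \<and> absolute_constant C2 \<and> absolute_constant C3 \<and>
    (\<forall>(M :: ('s, 'a) mdp) (\<pi> :: real ^ 'd::finite \<Rightarrow> 's \<Rightarrow> 'a \<Rightarrow> real) \<pi>opt
       Mg Mh l2 \<mu>F \<epsilon>bias \<theta>0 \<theta>1 d0.
      is_mdp M \<longrightarrow> param_policies M \<pi> \<longrightarrow> optimal_policy M \<pi>opt \<longrightarrow>
      smooth_policies M \<pi> Mg Mh \<longrightarrow>
      lipschitz_hess M \<pi> l2 \<longrightarrow>
      fisher_nondegenerate M \<pi> \<mu>F \<longrightarrow>
      compatible M \<pi> \<pi>opt \<epsilon>bias \<longrightarrow>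
      (let \<gamma> = disc M;
           gap = (\<lambda>T. exp_return M \<pi>opt -
             igt_value M \<pi> (horizon \<gamma> T) momentum (stepsize Mg \<mu>F) \<theta>0 \<theta>1 d0 T)
       in
         (\<forall>T\<ge>1. gap T \<le> C1 * (sigma_g (rmax M) \<gamma> Mg + L_h (rmax M) \<gamma> Mg Mh l2)
              / (real T + 1) powr (2 / 5) + sqrt \<epsilon>bias / (1 - \<gamma>)) \<and>
         (\<forall>\<epsilon>>0. let T\<epsilon> = max 1 (nat \<lceil>C2 * \<epsilon> powr (- (5 / 2))\<rceil>) in
            (\<forall>T\<ge>T\<epsilon>. gap T \<le> \<epsilon> + sqrt \<epsilon>bias / (1 - \<gamma>)) \<and>
            real (sample_count \<gamma> T\<epsilon>)
              \<le> C3 / (1 - \<gamma>) * \<epsilon> powr (- (5 / 2)) * ln (2 + 1 / \<epsilon>))))"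
proof (rule exI[of _ 1], rule exI[of _ 1], rule exI[of _ 4],
    intro conjI allI impI)
  \<comment> \<open>\<open>C1 = C2 = 1\<close>: the rate term and \<open>\<epsilon>\<close> are
    non-negative summands added to a gap bound that holds for every \<open>T\<close>.
    \<open>C3 = 4\<close> is the constant of \<open>sample_count_bound\<close>.\<close>
  fix M :: "('s, 'a) mdp" and \<pi> :: "real ^ 'd::finite \<Rightarrow> 's \<Rightarrow> 'a \<Rightarrow> real"
    and \<pi>opt Mg Mh l2 \<mu>F \<epsilon>bias \<theta>0 \<theta>1 d0
  assume M: "is_mdp M" and p: "param_policies M \<pi>" and opt: "optimal_policy M \<pi>opt"
    and sm: "smooth_policies M \<pi> Mg Mh" and fi: "fisher_nondegenerate M \<pi> \<mu>F"
    and co: "compatible M \<pi> \<pi>opt \<epsilon>bias"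
  interpret policy_class M \<pi> Mg Mh by unfold_locales fact+
  let ?b = "sqrt \<epsilon>bias / (1 - disc M)"
  let ?gap = "\<lambda>T. exp_return M \<pi>opt -
    igt_value M \<pi> (horizon (disc M) T) momentum (stepsize Mg \<mu>F) \<theta>0 \<theta>1 d0 T"
  have "\<pi>opt \<in> policies M" using opt by (simp add: optimal_policy_def)
  from gap_le_bias[OF this fi co] have "exp_return M \<pi>opt - ?b \<le> J_fun M \<pi> \<theta>" for \<theta>
    by (simp add: algebra_simps)
  from igt_value_ge[OF this] have gap: "?gap T \<le> ?b" for T by (simp add: algebra_simps)
  have "0 \<le> sigma_g (rmax M) (disc M) Mg + L_h (rmax M) (disc M) Mg Mh l2"
    using rate_nonneg[OF rmax disc Mg_pos Mh_pos] by (intro add_nonneg_nonneg)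
  then have "0 \<le> 1 * (sigma_g (rmax M) (disc M) Mg + L_h (rmax M) (disc M) Mg Mh l2) / (real T + 1) powr (2 / 5)" for T
    by simp
  then have 1: "?gap T \<le> 1 * (sigma_g (rmax M) (disc M) Mg + L_h (rmax M) (disc M) Mg Mh l2)
      / (real T + 1) powr (2 / 5) + ?b" for T
    using gap[of T] by (meson add_increasing order_trans)
  have 2: "?gap T \<le> \<epsilon> + ?b" if "0 < \<epsilon>" for \<epsilon> T
    using gap[of T] that by linarith
  show "let \<gamma> = disc M;
           gap = (\<lambda>T. exp_return M \<pi>opt -
             igt_value M \<pi> (horizon \<gamma> T) momentum (stepsize Mg \<mu>F) \<theta>0 \<theta>1 d0 T)
       in
         (\<forall>T\<ge>1. gap T \<le> 1 * (sigma_g (rmax M) \<gamma> Mg + L_h (rmax M) \<gamma> Mg Mh l2)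
              / (real T + 1) powr (2 / 5) + sqrt \<epsilon>bias / (1 - \<gamma>)) \<and>
         (\<forall>\<epsilon>>0. let T\<epsilon> = max 1 (nat \<lceil>1 * \<epsilon> powr (- (5 / 2))\<rceil>) in
            (\<forall>T\<ge>T\<epsilon>. gap T \<le> \<epsilon> + sqrt \<epsilon>bias / (1 - \<gamma>)) \<and>
            real (sample_count \<gamma> T\<epsilon>)
              \<le> 4 / (1 - \<gamma>) * \<epsilon> powr (- (5 / 2)) * ln (2 + 1 / \<epsilon>))"
    unfolding Let_def mult_1
    using 1[unfolded mult_1] 2 sample_count_bound[OF _ disc] by blast
qed (simp_all add: absolute_constant_def)

end
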